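(* Let $G$ be a finite simple graph such that $e(H)\leq \frac{18}{5}v(H)$ for every subgraph $H$ of $G$ and $e(H)\leq \frac{5}{2}v(H)$ for every bipartite subgraph $H$ of $G$. If $\Delta(G)\geq 11$, then $G$ has an equitable $r$-coloring for every integer $r\geq \Delta(G)$.
   Context: $e(H)$ and $v(H)$ denote the numbers of edges and vertices of $H$, and $\Delta(G)$ is the maximum degree of $G$. An equitable $r$-coloring of a graph $G$ is a partition of $V(G)$ into $r$ independent sets $V_1,\ldots,V_r$ (some possibly empty) such that $\bigl||V_i|-|V_j|\bigr|\leq 1$ for all $i,j$. *)

theory Defs
  imports Complex_Main "HOL-Library.Disjoint_Sets"
begin

type_synonym 'a ugraph = "'a set \<times> 'a set set"

definition verts :: "'a ugraph \<Rightarrow> 'a set" where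
  "verts G = fst G"

definition edges :: "'a ugraph \<Rightarrow> 'a set set" where
  "edges G = snd G"

definition fin_simple_graph :: "'a ugraph \<Rightarrow> bool" where
  "fin_simple_graph G \<longleftrightarrow>
     finite (verts G) \<and> (\<forall>e\<in>edges G. e \<subseteq> verts G \<and> card e = 2)"

definition num_verts :: "'a ugraph \<Rightarrow> nat" where
  "num_verts G = card (verts G)"

definition num_edges :: "'a ugraph \<Rightarrow> nat" where
  "num_edges G = card (edges G)"

text \<open>The graph condition on H ensures that every edge of H has both ends in H.\<close>

definition subgraph :: "'a ugraph \<Rightarrow> 'a ugraph \<Rightarrow> bool" where
  "subgraph H G \<longleftrightarrow>
     fin_simple_graph H \<and> verts H \<subseteq> verts G \<and> edges H \<subseteq> edges G"

definition independent_set :: "'a ugraph \<Rightarrow> 'a set \<Rightarrow> bool" where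
  "independent_set G S \<longleftrightarrow> S \<subseteq> verts G \<and> (\<forall>x\<in>S. \<forall>y\<in>S. {x, y} \<notin> edges G)"

definition bipartite :: "'a ugraph \<Rightarrow> bool" where
  "bipartite G \<longleftrightarrow>
     (\<exists>A B. A \<union> B = verts G \<and> A \<inter> B = {} \<and> independent_set G A \<and> independent_set G B)"

definition degree :: "'a ugraph \<Rightarrow> 'a \<Rightarrow> nat" where
  "degree G v = card {e \<in> edges G. v \<in> e}"

text \<open>Inserting 0 only serves to give the graph without vertices maximum degree 0.\<close>

definition max_degree :: "'a ugraph \<Rightarrow> nat" where
  "max_degree G = Max (insert 0 (degree G ` verts G))"

definition equitable_coloring :: "'a ugraph \<Rightarrow> nat \<Rightarrow> (nat \<Rightarrow> 'a set) \<Rightarrow> bool" where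
  "equitable_coloring G r C \<longleftrightarrow>
     (\<Union>i\<in>{1..r}. C i) = verts G \<and>
     disjoint_family_on C {1..r} \<and>
     (\<forall>i\<in>{1..r}. independent_set G (C i)) \<and>
     (\<forall>i\<in>{1..r}. \<forall>j\<in>{1..r}. \<bar>int (card (C i)) - int (card (C j))\<bar> \<le> 1)"

end

theory Submission
  imports Defs
begin

text \<open>
  Any remainder of the vertex count modulo r is absorbed either greedily, by removing vertices of
  degree at most 7, or by adding a clique on at most 6 vertices; so let the number of vertices be rs.
  Inserting vertices one at a time, we have a vertex x of degree at most 7 and an
  r-colouring of the rest in which all classes have size s except one class of size s - 1. Draw an arc
  from a class to another one if some vertex can be moved along it. If x fits into a class from
  which the small class is reachable, shifting vertices along a path finishes the proof. Otherwise
  x and every vertex in an inaccessible class has a neighbour in each accessible class, and the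
  bipartite bound, together with the degree of x, leaves at most three accessible classes; the same
  bound shows that the arcs are almost strongly connected on the inaccessible classes.

  Take a colouring with the maximum number of accessible classes and an accessible class U whose
  removal does not disconnect the others from the small class. If z in U is the only neighbour in U of
  y and y', and z can replace y among the inaccessible classes, then exchanging z and y makes the
  class of y' accessible unless y and y' are adjacent. Hence the vertices attached to U
  only through z almost form a clique. Double counting the edges at U provides a z for which this
  almost-clique violates the bound 18/5.
\<close>

subsection \<open>Shifting vertices along a path of colour classes\<close>

text \<open>The bipartite bound acts on classes through one computation. If h classes are each
  joined by at least \<open>s\<close> edges to each of the other r - h, then h(r - h)s <= 5/2 (rs -
  1), and this fails for 4 <= h <= r - 4 once 8(r - 4) >= 5r, that is, once r >= 11. Hence a set of
  classes closed in a suitable sense has at most 3 or at least r - 3 members. Sets of up to three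
  classes escape the count: these are the accessible classes and a few inaccessible ones that reach
  little or cannot be reached. All of them share one budget of 3, and they limit how often the
  exchange of z and y is available. If the almost-clique has k vertices besides z, of which n may
  fail to be joined to each other, the density bound gives 5k(k + 1) <= 36(k + 1) + 5n(n - 1). The
  margin is small: k = 10 and n = 6 give 550 against 546. When the budget is used up and k may be
  smaller, the structure of the colouring after the exchange is needed as well.\<close>

definition cls :: "('a \<Rightarrow> nat) \<Rightarrow> 'a set \<Rightarrow> nat \<Rightarrow> 'a set" where
  "cls c W i = {v \<in> W. c v = i}"

text \<open>Cycles are cut out. The last conjunct later confines such a path to the inaccessible
  classes.\<close>

lemma rtranclp_distinct_path:
  assumes "R\<^sup>*\<^sup>* i j"
  shows "\<exists>p. p \<noteq> [] \<and> hd p = i \<and> last p = j \<and> distinct p \<and> successively R p \<and> (\<forall>k\<in>set p. R\<^sup>*\<^sup>* i k)"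
  using assms
proof (induction rule: converse_rtranclp_induct)
  case base
  show ?case by (rule exI[of _ "[j]"]) simp
next
  case (step i k)
  then obtain p where p: "p \<noteq> []" "hd p = k" "last p = j" "distinct p" "successively R p"
    "\<forall>l\<in>set p. R\<^sup>*\<^sup>* k l" by blast
  have reach: "\<forall>l\<in>set p. R\<^sup>*\<^sup>* i l"
    using p(6) step(1) by (meson converse_rtranclp_into_rtranclp)
  show ?case
  proof (cases "i \<in> set p")
    case True
    then obtain ys zs where yz: "p = ys @ i # zs" by (meson split_list)
    have "successively R (i # zs)" using p(5) yz by (simp add: successively_append_iff)
    then show ?thesis using p reach yz by (intro exI[of _ "i # zs"]) auto
  next
    case False
    then show ?thesis using p reach step(1)
      by (intro exI[of _ "i # p"]) (cases p, auto)
  qed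
qed

locale symgraph =
  fixes adj :: "'a \<Rightarrow> 'a \<Rightarrow> bool"
  assumes sym: "adj u v \<Longrightarrow> adj v u"
    and irrefl: "\<not> adj v v"
begin

definition nb :: "'a \<Rightarrow> 'a set \<Rightarrow> 'a set" where
  "nb v S = {u \<in> S. adj v u}"

definition proper :: "('a \<Rightarrow> nat) \<Rightarrow> 'a set \<Rightarrow> bool" where
  "proper c W \<longleftrightarrow> (\<forall>u\<in>W. \<forall>v\<in>W. adj u v \<longrightarrow> c u \<noteq> c v)"

text \<open>An index \<open>j\<close> that is not used as a colour has an empty class, so \<open>arc c W i j\<close> then holds
  whenever class \<open>i\<close> is nonempty.\<close>

definition arc :: "('a \<Rightarrow> nat) \<Rightarrow> 'a set \<Rightarrow> nat \<Rightarrow> nat \<Rightarrow> bool" where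
  "arc c W i j \<longleftrightarrow> i \<noteq> j \<and> (\<exists>v\<in>cls c W i. nb v (cls c W j) = {})"

text \<open>The set \<open>Y\<close> is empty or a singleton in the applications: it is the vertex that leaves its
  class in exchange for \<open>z\<close>.\<close>

lemma shift_along_path:
  assumes "distinct p" "p \<noteq> []" "successively (arc c W) p" "proper c W" "finite W" "z \<notin> W"
    "Y \<subseteq> cls c W (last p)" "nb z (cls c W (hd p) - Y) = {}"
  shows "\<exists>c'. proper c' (insert z (W - Y)) \<and>
    (\<forall>v\<in>W. c v \<notin> set p \<longrightarrow> c' v = c v) \<and>
    (\<forall>v\<in>insert z W. v = z \<or> c v \<in> set p \<longrightarrow> c' v \<in> set p) \<and>
    (\<forall>i. card (cls c' (insert z (W - Y)) i) = card (cls c W i - Y) + (if i = last p then 1 else 0))"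
  using assms
proof (induction p arbitrary: c W z)
  case Nil
  then show ?case by simp
next
  case (Cons i p)
  show ?case
  proof (cases p)
    case Nil
    define c1 where "c1 = c(z := i)"
    have c1: "c1 z = i" "\<And>v. v \<noteq> z \<Longrightarrow> c1 v = c v" by (auto simp: c1_def)
    have "proper c1 (insert z (W - Y))"
      using Cons.prems Nil sym irrefl
      unfolding c1_def proper_def nb_def cls_def by (auto; blast)
    moreover have "card (cls c1 (insert z (W - Y)) k) = card (cls c W k - Y) + (if k = i then 1 else 0)" for k
    proof -
      have "cls c1 (insert z (W - Y)) k = (if k = i then insert z (cls c W k - Y) else cls c W k - Y)"
        using Cons.prems(6) by (auto simp: cls_def c1_def)
      moreover have "card (insert z (cls c W k - Y)) = Suc (card (cls c W k - Y))"
        using Cons.prems(5,6) by (intro card_insert_disjoint) (auto simp: cls_def)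
      ultimately show ?thesis by (cases "k = i") simp_all
    qed
    moreover have "\<forall>v\<in>W. c1 v = c v" using c1(2) Cons.prems(6) by metis
    ultimately show ?thesis using Cons.prems(6) Nil
      by (intro exI[of _ c1]) (auto simp: c1(1))
  next
    case (Cons i' p')
    note P = Cons.prems
    have ne: "last p \<noteq> i" "i' \<noteq> i" "i \<notin> set p" using P(1) Cons by auto
    have arc: "arc c W i i'" using P(3) Cons by simp
    then obtain v where v: "v \<in> cls c W i" "nb v (cls c W i') = {}" unfolding arc_def by blast
    \<comment> \<open>One step of the shift: \<open>z\<close> enters class \<open>i\<close>, and
      \<open>v\<close>, which fits into class \<open>i'\<close>, becomes the vertex to be inserted
      along the rest. As the path is distinct, the remaining classes and \<open>Y\<close> are
      untouched.\<close>
    let ?W = "insert z (W - {v})" and ?c = "c(z := i)"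
    have vz: "v \<noteq> z" "v \<in> W" "c v = i" using v P(6) by (auto simp: cls_def)
    have same: "cls ?c ?W k = cls c W k" if "k \<noteq> i" for k
      using that vz P(6) by (auto simp: cls_def)
    have Yc: "Y \<subseteq> cls c W (last p)" using P(7) Cons by simp
    have Yi: "cls c W i \<inter> Y = {}" using Yc ne by (auto simp: cls_def)
    have "\<exists>c'. proper c' (insert v (?W - Y)) \<and>
      (\<forall>w\<in>?W. ?c w \<notin> set p \<longrightarrow> c' w = ?c w) \<and>
      (\<forall>w\<in>insert v ?W. w = v \<or> ?c w \<in> set p \<longrightarrow> c' w \<in> set p) \<and>
      (\<forall>k. card (cls c' (insert v (?W - Y)) k) = card (cls ?c ?W k - Y) + (if k = last p then 1 else 0))"
    proof (rule Cons.IH)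
      show "distinct p" "p \<noteq> []" using P(1) Cons by auto
      have "successively (arc c W) p" using P(3) Cons by simp
      moreover have "arc ?c ?W k l \<longleftrightarrow> arc c W k l" if "k \<in> set p" "l \<in> set p" for k l
      proof -
        have "k \<noteq> i" "l \<noteq> i" using that ne(3) by auto
        then show ?thesis unfolding arc_def using same by presburger
      qed
      ultimately show "successively (arc ?c ?W) p"
        using successively_cong[of p "arc ?c ?W" "arc c W" p] by blast
      show "finite ?W" using P(5) by simp
      show "v \<notin> ?W" using vz by simp
      show "Y \<subseteq> cls ?c ?W (last p)" using same[OF ne(1)] Yc by simp
      show "nb v (cls ?c ?W (hd p) - Y) = {}" using same[OF ne(2)] v(2) Cons by (auto simp: nb_def)
      have z: "nb z (cls c W i) = {}" using P(8) Yi by (auto simp: nb_def)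
      then have zz: "\<not> adj z w" "\<not> adj w z" if "w \<in> W" "c w = i" for w
        using that sym by (auto simp: nb_def cls_def)
      show "proper ?c ?W"
        using P(4,6) zz irrefl unfolding proper_def by auto
    qed
    then obtain c' where c': "proper c' (insert v (?W - Y))"
      "\<forall>w\<in>?W. ?c w \<notin> set p \<longrightarrow> c' w = ?c w"
      "\<forall>w\<in>insert v ?W. w = v \<or> ?c w \<in> set p \<longrightarrow> c' w \<in> set p"
      "\<forall>k. card (cls c' (insert v (?W - Y)) k) = card (cls ?c ?W k - Y) + (if k = last p then 1 else 0)"
      by blast
    have vY: "v \<notin> Y" "z \<notin> Y" using Yi v P(6) Yc by (auto simp: cls_def)
    then have set_eq: "insert v (?W - Y) = insert z (W - Y)" using vz by auto
    have "card (cls ?c ?W k - Y) = card (cls c W k - Y)" for k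
    proof (cases "k = i")
      case True
      have "cls ?c ?W i - Y = insert z ((cls c W i - Y) - {v})"
        using vz P(6) vY by (auto simp: cls_def)
      moreover have "v \<in> cls c W i - Y" "finite (cls c W i - Y)" "z \<notin> cls c W i - Y - {v}"
        using v vY P(5,6) by (auto simp: cls_def)
      ultimately show ?thesis using True
        by (metis card_insert_disjoint finite_Diff card_Suc_Diff1)
    qed (simp add: same)
    moreover have "\<forall>w\<in>W. c w \<notin> set (i # p) \<longrightarrow> c' w = c w"
    proof (intro ballI impI)
      fix w assume w: "w \<in> W" "c w \<notin> set (i # p)"
      then have "w \<noteq> v" "w \<noteq> z" using vz P(6) by auto
      then show "c' w = c w" using bspec[OF c'(2), of w] w by simp
    qed
    moreover have "\<forall>w\<in>insert z W. w = z \<or> c w \<in> set (i # p) \<longrightarrow> c' w \<in> set (i # p)"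
    proof (intro ballI impI)
      fix w assume w: "w \<in> insert z W" "w = z \<or> c w \<in> set (i # p)"
      show "c' w \<in> set (i # p)"
      proof (cases "w = v \<or> ?c w \<in> set p")
        case True
        then show ?thesis using c'(3) w vz by auto
      next
        case False
        then have "c' w = ?c w" using c'(2) w by auto
        then show ?thesis using False w by auto
      qed
    qed
    ultimately show ?thesis using c' set_eq Cons by (intro exI[of _ c']) simp
  qed
qed

text \<open>Every \<open>y\<close> contributes at least 2 to the right-hand side: a single neighbour
  in \<open>U\<close> is counted once as a neighbour and once more because it is the only
  one.\<close>

lemma double_count_solos:
  assumes "finite U" "finite Y" "\<forall>y\<in>Y. nb y U \<noteq> {}"
  shows "2 * card Y \<le> (\<Sum>z\<in>U. card {y\<in>Y. nb y U = {z}} + card (nb z Y))"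
proof -
  have "(\<Sum>z\<in>U. card {y\<in>Y. nb y U = {z}} + card (nb z Y))
      = (\<Sum>z\<in>U. \<Sum>y\<in>Y. (if nb y U = {z} then 1 else 0) + (if adj z y then 1 else 0))"
    using assms(2) by (simp add: sum.distrib nb_def sum.If_cases Int_def)
  also have "\<dots> = (\<Sum>y\<in>Y. \<Sum>z\<in>U. (if nb y U = {z} then 1 else 0) + (if adj z y then 1 else 0))"
    by (rule sum.swap)
  also have "\<dots> \<ge> (\<Sum>y\<in>Y. 2)"
  proof (rule sum_mono)
    fix y assume y: "y \<in> Y"
    have eq: "(\<Sum>z\<in>U. (if nb y U = {z} then 1 else 0) + (if adj z y then 1 else 0))
       = card {z\<in>U. nb y U = {z}} + card (nb y U)"
    proof -
      have "{z\<in>U. adj z y} = nb y U" using sym by (auto simp: nb_def)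
      then show ?thesis using assms(1) by (simp add: sum.distrib sum.If_cases Int_def)
    qed
    have fin: "finite (nb y U)" using assms(1) by (simp add: nb_def)
    show "2 \<le> (\<Sum>z\<in>U. (if nb y U = {z} then 1 else 0) + (if adj z y then 1 else (0::nat)))"
    proof (cases "card (nb y U) \<ge> 2")
      case True then show ?thesis using eq by linarith
    next
      case False
      have "card (nb y U) \<noteq> 0" using assms(3) y fin by simp
      then have "card (nb y U) = 1" using False by linarith
      then obtain z where z: "nb y U = {z}" by (auto simp: card_1_singleton_iff)
      then have "{z'\<in>U. nb y U = {z'}} = {z}" by (auto simp: nb_def)
      then show ?thesis using eq z by simp
    qed
  qed
  finally show ?thesis by simp
qed

end

subsection \<open>Accessible and inaccessible classes\<close>

text \<open>Edges are counted as ordered pairs in the first bound, whence 36 instead of 18.\<close>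

locale sparse_graph = symgraph adj for adj :: "'a \<Rightarrow> 'a \<Rightarrow> bool" +
  fixes V :: "'a set"
  assumes finV: "finite V"
    and sparse: "X \<subseteq> V \<Longrightarrow> 5 * card {(u, v). u \<in> X \<and> v \<in> X \<and> adj u v} \<le> 36 * card X"
    and bipartite_sparse: "\<lbrakk>X \<subseteq> V; Y \<subseteq> V; X \<inter> Y = {}\<rbrakk> \<Longrightarrow>
      2 * card {(u, v). u \<in> X \<and> v \<in> Y \<and> adj u v} \<le> 5 * (card X + card Y)"
begin

text \<open>All ordered pairs of distinct vertices of \<open>insert z S\<close> are adjacent except
  possibly those inside \<open>R\<close>; compare their number with \<open>sparse\<close>.\<close>

lemma near_clique_bound:
  assumes "S \<subseteq> V" "z \<in> V" "z \<notin> S" "R \<subseteq> S" "\<forall>y\<in>S. adj z y"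
    and joined: "\<forall>y\<in>S - R. \<forall>y'\<in>S. y' \<noteq> y \<longrightarrow> adj y y'"
  shows "5 * ((card S + 1) * card S) \<le> 36 * (card S + 1) + 5 * (card R * (card R - 1))"
proof -
  have fin: "finite S" "finite R"
    using finite_subset[OF assms(1) finV] finite_subset[OF assms(4)] by auto
  let ?X = "insert z S"
  let ?D = "\<lambda>X. {(a, b). a \<in> X \<and> b \<in> X \<and> a \<noteq> b}"
  have cardD: "card (?D X) = card X * (card X - 1)" if "finite X" for X :: "'a set"
  proof -
    have "?D X = Sigma X (\<lambda>a. X - {a})" by auto
    then have "card (?D X) = (\<Sum>a\<in>X. card (X - {a}))" using that by simp
    then show ?thesis using that by simp
  qed
  let ?P = "{(a, b). a \<in> ?X \<and> b \<in> ?X \<and> adj a b}"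
  have finP: "finite ?P" by (rule finite_subset[of _ "?X \<times> ?X"]) (use fin in auto)
  have finR: "finite (?D R)" by (rule finite_subset[of _ "R \<times> R"]) (use fin in auto)
  have "?D ?X \<subseteq> ?P \<union> ?D R"
  proof
    fix e assume "e \<in> ?D ?X"
    then obtain a b where ab: "e = (a, b)" "a \<in> ?X" "b \<in> ?X" "a \<noteq> b" by blast
    have "adj a b" if "\<not> (a \<in> R \<and> b \<in> R)"
    proof (cases "a = z \<or> b = z")
      case True
      then show ?thesis
      proof
        assume "a = z"
        then show ?thesis using ab assms(5) by auto
      next
        assume "b = z"
        then have "adj b a" using ab assms(5) by auto
        then show ?thesis by (rule sym)
      qed
    next
      case False
      then have S: "a \<in> S" "b \<in> S" using ab by auto
      show ?thesis
      proof (cases "a \<in> R")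
        case True
        then have "adj b a" using joined that S ab(4) by blast
        then show ?thesis by (rule sym)
      next
        case False
        then have "a \<in> S - R" using S by simp
        from bspec[OF bspec[OF joined this] S(2)] show ?thesis using ab(4) by simp
      qed
    qed
    then show "e \<in> ?P \<union> ?D R" using ab by blast
  qed
  then have "card (?D ?X) \<le> card ?P + card (?D R)"
    using card_mono[of "?P \<union> ?D R" "?D ?X"] card_Un_le[of ?P "?D R"] finP finR
    by (meson finite_UnI order_trans)
  moreover have "card (?D ?X) = (card S + 1) * card S" using cardD[of ?X] fin assms(3) by simp
  moreover have "5 * card ?P \<le> 36 * card ?X" using assms(1,2) by (intro sparse) simp
  ultimately show ?thesis using cardD[OF fin(2)] fin assms(3) by simp
qed

text \<open>The average degree is at most 36/5 < 8.\<close>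

lemma low_degree_vertex:
  assumes "X \<subseteq> V" "X \<noteq> {}"
  shows "\<exists>x\<in>X. card (nb x X) \<le> 7"
proof (rule ccontr)
  assume "\<not> ?thesis"
  then have gt: "8 \<le> card (nb x X)" if "x \<in> X" for x using that by fastforce
  have fin: "finite X" using assms finV finite_subset by blast
  have "{(u, v). u \<in> X \<and> v \<in> X \<and> adj u v} = Sigma X (\<lambda>u. nb u X)" by (auto simp: nb_def)
  then have "card {(u, v). u \<in> X \<and> v \<in> X \<and> adj u v} = (\<Sum>u\<in>X. card (nb u X))"
    using fin by (simp add: nb_def)
  also have "\<dots> \<ge> (\<Sum>u\<in>X. 8)" by (rule sum_mono) (use gt in auto)
  finally have "card X * 8 \<le> card {(u, v). u \<in> X \<and> v \<in> X \<and> adj u v}" by simp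
  then show False using sparse[OF assms(1)] assms(2) fin card_gt_0_iff[of X] by linarith
qed

end

text \<open>The setting of a proof by contradiction: \<open>no_equitable\<close> denies the desired
  colouring, and the goal is \<open>no_config\<close>, that no colouring of \<open>V - {x}\<close>
  with one class a vertex short exists either.\<close>

locale float_graph = sparse_graph adj V for adj :: "'a \<Rightarrow> 'a \<Rightarrow> bool" and V +
  fixes r s sm :: nat and x :: 'a
  assumes cardV: "card V = r * s"
    and r11: "11 \<le> r"
    and deg: "v \<in> V \<Longrightarrow> card (nb v V) \<le> r"
    and xV: "x \<in> V" and degx: "card (nb x V) \<le> 7"
    and sm_less: "sm < r"
    and no_equitable: "\<And>c. \<lbrakk>proper c V; \<forall>v\<in>V. c v < r\<rbrakk> \<Longrightarrow> \<exists>i<r. card (cls c V i) \<noteq> s"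
begin

text \<open>The vertex \<open>f\<close> is uncoloured, and \<open>sm\<close> is the index of the small class.\<close>

definition config :: "('a \<Rightarrow> nat) \<Rightarrow> 'a \<Rightarrow> bool" where
  "config c f \<longleftrightarrow> f \<in> V \<and> proper c (V - {f}) \<and> (\<forall>v\<in>V - {f}. c v < r) \<and>
     (\<forall>i<r. card (cls c (V - {f}) i) = (if i = sm then s - 1 else s))"

abbreviation "Cl c \<equiv> cls c (V - {x})"
abbreviation "ar c \<equiv> arc c (V - {x})"

definition acc :: "('a \<Rightarrow> nat) \<Rightarrow> nat set" where
  "acc c = {i. i < r \<and> (ar c)\<^sup>*\<^sup>* i sm}"

definition inacc :: "('a \<Rightarrow> nat) \<Rightarrow> nat set" where
  "inacc c = {..<r} - acc c"

lemma s_pos: "0 < s"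
proof (rule ccontr)
  assume "\<not> 0 < s"
  then have "V = {}" using cardV finV by simp
  then show False using xV by blast
qed

lemma finCl [simp]: "finite (Cl c i)" "finite (nb v (Cl c i))"
  using finV by (auto simp: cls_def nb_def)

lemma fin_acc [simp]: "finite (acc c)" "finite (inacc c)"
  by (auto simp: acc_def inacc_def)

lemma sm_acc [simp]: "sm \<in> acc c" "sm \<notin> inacc c"
  using sm_less by (auto simp: acc_def inacc_def)

lemma acc_inacc: "acc c \<union> inacc c = {..<r}" "acc c \<inter> inacc c = {}"
  by (auto simp: acc_def inacc_def)

lemma card_acc_inacc: "card (acc c) + card (inacc c) = r"
  by (metis acc_inacc card_Un_disjoint card_lessThan fin_acc)

lemma arc_less:
  assumes "config c f" "arc c (V - {f}) i j"
  shows "i < r"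
  using assms by (auto simp: config_def arc_def cls_def)

lemma path_less:
  assumes "config c f" "successively (arc c (V - {f})) q" "q \<noteq> []" "last q < r"
  shows "set q \<subseteq> {..<r}"
  using assms(2-4) arc_less[OF assms(1)] by (induction q rule: induct_list012) auto

lemma arc_acc:
  assumes "config c x" "i < r" "ar c i j" "j \<in> acc c"
  shows "i \<in> acc c"
  using assms by (auto simp: acc_def intro: converse_rtranclp_into_rtranclp)

text \<open>Shifting along a path from \<open>i\<close> to \<open>sm\<close> with
  \<open>Y = {}\<close> colours \<open>f\<close> and enlarges only the small class, contrary to
  \<open>no_equitable\<close>. The uncoloured vertex is kept general since it is not always
  \<open>x\<close>.\<close>

lemma no_win:
  assumes "config c f" "nb f (cls c (V - {f}) i) = {}" "i < r" "(arc c (V - {f}))\<^sup>*\<^sup>* i sm"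
  shows False
proof -
  let ?W = "V - {f}"
  obtain p where p: "p \<noteq> []" "hd p = i" "last p = sm" "distinct p" "successively (arc c ?W) p"
    using rtranclp_distinct_path[OF assms(4)] by blast
  have "\<exists>c'. proper c' (insert f (?W - {})) \<and>
    (\<forall>v\<in>?W. c v \<notin> set p \<longrightarrow> c' v = c v) \<and>
    (\<forall>v\<in>insert f ?W. v = f \<or> c v \<in> set p \<longrightarrow> c' v \<in> set p) \<and>
    (\<forall>i. card (cls c' (insert f (?W - {})) i) = card (cls c ?W i - {}) + (if i = last p then 1 else 0))"
    by (rule shift_along_path) (use p assms finV in \<open>auto simp: config_def\<close>)
  moreover have "insert f (?W - {}) = V" using assms(1) by (auto simp: config_def)
  ultimately obtain c' where c': "proper c' V" "\<forall>v\<in>?W. c v \<notin> set p \<longrightarrow> c' v = c v"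
    "\<forall>v\<in>V. v = f \<or> c v \<in> set p \<longrightarrow> c' v \<in> set p"
    "\<forall>i. card (cls c' V i) = card (cls c ?W i) + (if i = sm then 1 else 0)"
    using p(3) by auto
  have "set p \<subseteq> {..<r}" using path_less[OF assms(1) p(5,1)] p(3) sm_less by simp
  then have "c' v < r" if "v \<in> V" for v
    using c'(2,3) assms(1) that unfolding config_def
    by (metis DiffI lessThan_iff singletonD subsetD)
  moreover have "card (cls c' V i) = s" if "i < r" for i
    using c'(4) assms(1) s_pos that by (auto simp: config_def)
  ultimately show False using no_equitable[OF c'(1)] by blast
qed

lemma x_hits:
  assumes "config c x" "i \<in> acc c"
  shows "nb x (Cl c i) \<noteq> {}"
  using no_win[OF assms(1), of i] assms(2) by (auto simp: acc_def)

lemma inacc_hits: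
  assumes "config c x" "i \<in> acc c" "v \<in> Cl c j" "j \<in> inacc c"
  shows "nb v (Cl c i) \<noteq> {}"
proof
  assume "nb v (Cl c i) = {}"
  moreover have "j \<noteq> i" using assms acc_inacc by blast
  ultimately have "ar c j i" using assms by (auto simp: arc_def)
  then have "j \<in> acc c" using arc_acc[OF assms(1)] assms acc_inacc by blast
  then show False using assms acc_inacc by blast
qed

text \<open>The small class contains a neighbour of \<open>x\<close>. The bound beats an error term
  of 1 in \<open>no_corner\<close>.\<close>

lemma s_ge_2: assumes "config c x" shows "2 \<le> s"
proof -
  have "Cl c sm \<noteq> {}" using x_hits[OF assms sm_acc(1)] by (auto simp: nb_def)
  then have "0 < card (Cl c sm)" by (simp add: card_gt_0_iff)
  moreover have "card (Cl c sm) = s - 1" using assms sm_less by (simp add: config_def)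
  ultimately show ?thesis by linarith
qed

lemma card_Cl_inacc:
  assumes "config c x" "i \<in> inacc c"
  shows "card (Cl c i) = s"
  using assms sm_acc by (auto simp: config_def inacc_def)

section \<open>Edge counts between colour classes\<close>

definition ecount :: "('a \<Rightarrow> nat) \<Rightarrow> nat \<Rightarrow> nat \<Rightarrow> nat" where
  "ecount c i j = card {(u, v). u \<in> Cl c i \<and> v \<in> Cl c j \<and> adj u v}"

lemma fin_epairs: "finite {(u, v). u \<in> Cl c i \<and> v \<in> Cl c j \<and> adj u v}"
  by (rule finite_subset[of _ "Cl c i \<times> Cl c j"]) auto

lemma ecount_ge_card:
  assumes "\<forall>v\<in>Cl c j. nb v (Cl c i) \<noteq> {}"
  shows "card (Cl c j) \<le> ecount c i j"
proof -
  let ?P = "{(u, v). u \<in> Cl c i \<and> v \<in> Cl c j \<and> adj u v}"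
  have "Cl c j \<subseteq> snd ` ?P"
  proof
    fix v assume v: "v \<in> Cl c j"
    then obtain u where "u \<in> Cl c i" "adj v u" using assms by (auto simp: nb_def)
    then show "v \<in> snd ` ?P" using v sym by (force simp: image_iff)
  qed
  then have "card (Cl c j) \<le> card (snd ` ?P)" using fin_epairs by (intro card_mono) auto
  also have "\<dots> \<le> card ?P" by (rule card_image_le[OF fin_epairs])
  finally show ?thesis unfolding ecount_def .
qed

lemma ecount_sym: "ecount c i j = ecount c j i"
proof -
  have "{(u, v). u \<in> Cl c i \<and> v \<in> Cl c j \<and> adj u v}
    = prod.swap ` {(u, v). u \<in> Cl c j \<and> v \<in> Cl c i \<and> adj u v}"
    using sym by (auto simp: image_iff)
  then show ?thesis unfolding ecount_def by (simp add: card_image)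
qed

lemma ecount_sum_bound:
  assumes "config c x" "H \<subseteq> {..<r}"
  shows "2 * (\<Sum>i\<in>H. \<Sum>j\<in>{..<r} - H. ecount c i j) \<le> 5 * (r * s - 1)"
proof -
  let ?L = "{..<r} - H"
  let ?P = "\<lambda>(i, j). {(u, v). u \<in> Cl c i \<and> v \<in> Cl c j \<and> adj u v}"
  let ?X = "{v \<in> V - {x}. c v \<in> H}" and ?Y = "{v \<in> V - {x}. c v \<in> ?L}"
  have finH: "finite H" using assms(2) finite_subset by blast
  have "(\<Sum>i\<in>H. \<Sum>j\<in>?L. ecount c i j) = (\<Sum>p\<in>H \<times> ?L. card (?P p))"
    unfolding ecount_def sum.cartesian_product by (rule sum.cong) auto
  also have "\<dots> = card (\<Union>p\<in>H \<times> ?L. ?P p)"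
    by (rule card_UN_disjoint[symmetric]) (use finH fin_epairs in \<open>auto simp: cls_def\<close>)
  also have "(\<Union>p\<in>H \<times> ?L. ?P p) = {(u, v). u \<in> ?X \<and> v \<in> ?Y \<and> adj u v}"
    by (auto simp: cls_def)
  finally have eq: "(\<Sum>i\<in>H. \<Sum>j\<in>?L. ecount c i j) = card {(u, v). u \<in> ?X \<and> v \<in> ?Y \<and> adj u v}" .
  have "card ?X + card ?Y = card (?X \<union> ?Y)"
    by (rule card_Un_disjoint[symmetric]) (use finV in auto)
  also have "?X \<union> ?Y = V - {x}" using assms by (auto simp: config_def)
  also have "card (V - {x}) = r * s - 1" using cardV xV finV by simp
  finally have "card ?X + card ?Y = r * s - 1" .
  then show ?thesis unfolding eq using bipartite_sparse[of ?X ?Y] by fastforce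
qed

text \<open>Otherwise \<open>H\<close> sends at least \<open>card H * (r - card H) * s\<close> edges
  to its complement, and the product of the first two factors is at least 4(r - 4). Here 8(r - 4) >
  5r uses r >= 11.\<close>

lemma heavy_classes:
  assumes "config c x" "H \<subseteq> {..<r}"
    and dense: "\<And>i j. i \<in> H \<Longrightarrow> j \<in> {..<r} - H \<Longrightarrow> s \<le> ecount c i j"
  shows "card H \<le> 3 \<or> r \<le> card H + 3"
proof (rule ccontr)
  assume "\<not> ?thesis"
  then have h: "4 \<le> card H" "card H + 4 \<le> r" by auto
  have finH: "finite H" using assms(2) finite_subset by blast
  have "(\<Sum>i\<in>H. \<Sum>j\<in>{..<r} - H. s) \<le> (\<Sum>i\<in>H. \<Sum>j\<in>{..<r} - H. ecount c i j)"
    by (intro sum_mono dense)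
  moreover have "(\<Sum>i\<in>H. \<Sum>j\<in>{..<r} - H. s) = card H * (r - card H) * s"
    using assms(2) finH by (simp add: card_Diff_subset mult.assoc)
  ultimately have b: "2 * (card H * (r - card H) * s) \<le> 5 * (r * s - 1)"
    using ecount_sum_bound[OF assms(1,2)] by linarith
  obtain k where k: "card H = k + 4" using h(1) by (metis add.commute le_Suc_ex)
  obtain l where l: "r = card H + 4 + l" using h(2) by (metis le_Suc_ex)
  have "4 * (r - 4) \<le> card H * (r - card H)" using k l by (simp add: algebra_simps)
  then have "2 * (4 * (r - 4) * s) \<le> 5 * (r * s - 1)"
    using b by (meson mult_le_mono1 mult_le_mono2 order_trans)
  moreover have "5 * r < 8 * (r - 4)" using r11 by linarith
  then have "5 * r * s < 8 * (r - 4) * s" using s_pos by simp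
  ultimately show False by (simp add: algebra_simps)
qed

text \<open>Each accessible class contains a neighbour of \<open>x\<close>, so there are at most 7 <
  r - 3 of them. This rules out the second alternative of \<open>heavy_classes\<close>.\<close>

lemma card_acc_le_3: assumes "config c x" shows "card (acc c) \<le> 3"
proof -
  have "card (acc c) \<le> card (nb x V)"
  proof (rule surj_card_le)
    show "finite (nb x V)" using finV by (simp add: nb_def)
    show "acc c \<subseteq> c ` nb x V"
    proof
      fix i assume "i \<in> acc c"
      then obtain v where "v \<in> nb x (Cl c i)" using x_hits[OF assms] by blast
      then show "i \<in> c ` nb x V" by (auto simp: nb_def cls_def)
    qed
  qed
  then have "card (acc c) \<le> 7" using degx by simp
  moreover have "card (acc c) \<le> 3 \<or> r \<le> card (acc c) + 3"
  proof (rule heavy_classes[OF assms])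
    show "acc c \<subseteq> {..<r}" by (auto simp: acc_def)
    fix i j assume i: "i \<in> acc c" and "j \<in> {..<r} - acc c"
    then have j: "j \<in> inacc c" by (simp add: inacc_def)
    show "s \<le> ecount c i j"
      using ecount_ge_card[of c j i] inacc_hits[OF assms i _ j] card_Cl_inacc[OF assms j] by auto
  qed
  ultimately show ?thesis using r11 by linarith
qed

lemma reach_less:
  assumes "config c f" "(arc c (V - {f}))\<^sup>*\<^sup>* i j" "j < r"
  shows "i < r"
  using assms(2,3) arc_less[OF assms(1)] by (cases rule: converse_rtranclpE) auto

lemma acc_nonempty: "acc c \<noteq> {}"
proof
  assume "acc c = {}"
  moreover have "sm \<in> acc c" by (rule sm_acc)
  ultimately show False by simp
qed

lemma card_acc_pos: "1 \<le> card (acc c)"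
  using acc_nonempty by (simp add: Suc_le_eq card_gt_0_iff)

lemma reach_inacc:
  assumes "config c x" "i \<in> inacc c" "(ar c)\<^sup>*\<^sup>* i j" "j < r"
  shows "j \<in> inacc c"
  using assms rtranclp_trans[OF assms(3)] by (auto simp: inacc_def acc_def)

lemma inacc_path:
  assumes "config c x" "i \<in> inacc c" "(ar c)\<^sup>*\<^sup>* i j" "j \<in> inacc c"
  obtains p where "p \<noteq> []" "hd p = i" "last p = j" "distinct p" "successively (ar c) p"
    "set p \<subseteq> inacc c"
proof -
  obtain p where p: "p \<noteq> []" "hd p = i" "last p = j" "distinct p" "successively (ar c) p"
    "\<forall>k\<in>set p. (ar c)\<^sup>*\<^sup>* i k"
    using rtranclp_distinct_path[OF assms(3)] by blast
  have "set p \<subseteq> {..<r}"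
    using path_less[OF assms(1) p(5,1)] p(3) assms(4) by (simp add: inacc_def)
  then have "set p \<subseteq> inacc c" using p(6) reach_inacc[OF assms(1,2)] by blast
  then show ?thesis using that p by blast
qed

lemma ecount_acc:
  assumes "config c x" "i \<in> acc c" "j \<in> inacc c"
  shows "s \<le> ecount c i j"
  using ecount_ge_card[of c j i] inacc_hits[OF assms(1,2) _ assms(3)] card_Cl_inacc[OF assms(1,3)] by auto

lemma ecount_no_arc:
  assumes "config c x" "i \<in> inacc c" "i \<noteq> j" "\<not> ar c i j"
  shows "s \<le> ecount c i j"
proof -
  have "\<forall>v\<in>Cl c i. nb v (Cl c j) \<noteq> {}" using assms(3,4) by (auto simp: arc_def)
  then show ?thesis using ecount_ge_card[of c i j] card_Cl_inacc[OF assms(1,2)] by (simp add: ecount_sym)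
qed

text \<open>Without an arc from class \<open>i\<close> to class \<open>j\<close>, every vertex of
  \<open>i\<close> has a neighbour in \<open>j\<close>, which gives \<open>s\<close> edges. So a set
  of inaccessible classes that no arc leaves towards other inaccessible classes is heavy.\<close>

lemma closed_dichotomy:
  assumes "config c x" "S \<subseteq> inacc c" and cl: "\<forall>i\<in>S. \<forall>j\<in>inacc c - S. \<not> ar c i j"
  shows "card S \<le> 3 \<or> r \<le> card S + 3"
proof (rule heavy_classes[OF assms(1)])
  show "S \<subseteq> {..<r}" using assms(2) by (auto simp: inacc_def)
  fix i j assume i: "i \<in> S" and j: "j \<in> {..<r} - S"
  have ib: "i \<in> inacc c" using i assms(2) by blast
  show "s \<le> ecount c i j"
  proof (cases "j \<in> acc c")
    case True
    then show ?thesis using ecount_acc[OF assms(1) True ib] by (simp add: ecount_sym)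
  next
    case False
    then have "j \<in> inacc c - S" using j by (auto simp: inacc_def)
    moreover from this have "i \<noteq> j" using i by blast
    ultimately show ?thesis using cl i ecount_no_arc[OF assms(1) ib] by blast
  qed
qed

text \<open>Here \<open>T\<close> collects the classes from which only few classes can be reached, and the complement
  of \<open>F\<close> the classes that cannot be reached from the others; \<open>F\<close> is a smallest large set of
  reachable classes.\<close>

lemma inacc_structure:
  assumes "config c x"
  obtains T F where "T \<subseteq> inacc c" "F \<subseteq> inacc c" "card (T \<union> (inacc c - F)) + card (acc c) \<le> 3"
    "\<forall>i\<in>inacc c - T. \<forall>j\<in>F. (ar c)\<^sup>*\<^sup>* i j"
    "\<forall>i\<in>F. \<forall>j\<in>inacc c - F. \<not> ar c i j"
    "\<forall>i\<in>T. \<forall>j\<in>inacc c - T. \<not> ar c i j"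
proof -
  let ?B = "inacc c"
  define rc where "rc i = {j\<in>?B. (ar c)\<^sup>*\<^sup>* i j}" for i
  define T where "T = {i\<in>?B. card (rc i) \<le> 3}"
  have rcB: "rc i \<subseteq> ?B" and finrc: "finite (rc i)" for i unfolding rc_def by auto
  have self: "i \<in> rc i" if "i \<in> ?B" for i using that by (simp add: rc_def)
  have rc_mono: "rc j \<subseteq> rc i" if "j \<in> rc i" for i j
    using that by (auto simp: rc_def)
  have rc_arc: "j \<in> rc i" if "k \<in> rc i" "ar c k j" "j \<in> ?B" for i j k
    using that by (auto simp: rc_def)
  have finB: "finite ?B" by simp
  have cardB: "card (acc c) + card ?B = r" by (rule card_acc_inacc)
  have acc_pos: "1 \<le> card (acc c)" by (rule card_acc_pos)
  have acc3: "card (acc c) \<le> 3" by (rule card_acc_le_3[OF assms])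
  \<comment> \<open>Adding one set of size at most 3 to a union of size at most 3 yields at most 6 <
    r - 3 classes, so the dichotomy brings the closed union back to at most 3.\<close>
  have union: "card (\<Union>i\<in>X. rc i) \<le> 3" if "finite X" "X \<subseteq> T" for X
    using that
  proof (induction X rule: finite_induct)
    case (insert i X)
    let ?S = "\<Union>i\<in>insert i X. rc i"
    have "card ?S \<le> card (rc i) + card (\<Union>i\<in>X. rc i)" by (simp add: card_Un_le)
    moreover have "card (rc i) \<le> 3" "card (\<Union>i\<in>X. rc i) \<le> 3" using insert by (auto simp: T_def)
    ultimately have "card ?S \<le> 6" by linarith
    moreover have "card ?S \<le> 3 \<or> r \<le> card ?S + 3"
    proof (rule closed_dichotomy[OF assms])
      show "?S \<subseteq> ?B" using rcB by blast
      show "\<forall>k\<in>?S. \<forall>j\<in>?B - ?S. \<not> ar c k j" using rc_arc by blast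
    qed
    ultimately show ?case using r11 by linarith
  qed simp
  have TB: "T \<subseteq> ?B" by (auto simp: T_def)
  then have finT: "finite T" using finB finite_subset by blast
  have "T \<subseteq> (\<Union>i\<in>T. rc i)" using self TB by blast
  then have "card T \<le> card (\<Union>i\<in>T. rc i)" using finT finrc by (intro card_mono) auto
  then have cT: "card T \<le> 3" using union[OF finT] by simp
  have "\<not> ?B \<subseteq> T"
  proof
    assume "?B \<subseteq> T"
    then have "card ?B \<le> card T" by (rule card_mono[OF finT])
    then have "card ?B \<le> 3" using cT by linarith
    then show False using cardB acc3 r11 by linarith
  qed
  then obtain i1 where i1: "i1 \<in> ?B - T" by blast
  obtain i0 where i0: "i0 \<in> ?B - T" "\<forall>i. i \<in> ?B - T \<longrightarrow> card (rc i0) \<le> card (rc i)"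
    using ex_has_least_nat[of "\<lambda>i. i \<in> ?B - T", OF i1, of "\<lambda>i. card (rc i)"] by auto
  define F where "F = rc i0"
  have big: "r \<le> card (rc i) + 3" if "i \<in> ?B - T" for i
  proof -
    have "card (rc i) \<le> 3 \<or> r \<le> card (rc i) + 3"
      by (rule closed_dichotomy[OF assms]) (use rcB rc_arc in blast)+
    then show ?thesis using that by (auto simp: T_def)
  qed
  have FB: "F \<subseteq> ?B" and finF: "finite F" using rcB finrc by (auto simp: F_def)
  \<comment> \<open>Two sets of at least r - 3 classes among at most r - 1 share at least r - 5 > 3
    classes, hence one, \<open>k\<close>, outside \<open>T\<close>. Minimality of \<open>F\<close>
    gives \<open>rc k = F\<close>.\<close>
  have reachF: "F \<subseteq> rc i" if i: "i \<in> ?B - T" for i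
  proof -
    have "card (rc i \<union> F) \<le> card ?B" using rcB FB by (intro card_mono) auto
    moreover have "card (rc i) + card F = card (rc i \<union> F) + card (rc i \<inter> F)"
      using finrc finF by (rule card_Un_Int)
    ultimately have "3 < card (rc i \<inter> F)"
      using big[OF i] big[OF i0(1)] cardB acc_pos r11 unfolding F_def by linarith
    then have "\<not> rc i \<inter> F \<subseteq> T" using cT card_mono[OF finT, of "rc i \<inter> F"] by linarith
    then obtain k where k: "k \<in> rc i" "k \<in> F" "k \<notin> T" by blast
    have "rc k \<subseteq> F" using rc_mono k by (simp add: F_def)
    moreover have "card F \<le> card (rc k)" using i0(2) k FB unfolding F_def by blast
    ultimately have "rc k = F" using finF card_seteq by blast
    then show ?thesis using rc_mono[OF k(1)] by simp
  qed
  have Fcl: "\<forall>i\<in>F. \<forall>j\<in>?B - F. \<not> ar c i j" using rc_arc unfolding F_def by blast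
  have Tcl: "\<forall>i\<in>T. \<forall>j\<in>?B - T. \<not> ar c i j"
  proof (intro ballI notI)
    fix i j assume ij: "i \<in> T" "j \<in> ?B - T" "ar c i j"
    then have "rc j \<subseteq> rc i" using rc_arc[OF self] rc_mono TB by blast
    then have "card (rc j) \<le> card (rc i)" using finrc card_mono by blast
    then show False using ij by (auto simp: T_def)
  qed
  \<comment> \<open>The union is heavy too: every pair with a class outside has a missing arc in one
    direction or an accessible member. Its size is at most r + 3 - (r - 3) = 6, so the budget of 3
    covers all three kinds of classes together.\<close>
  let ?H = "acc c \<union> (T \<union> (?B - F))"
  have "card ?H \<le> 3 \<or> r \<le> card ?H + 3"
  proof (rule heavy_classes[OF assms])
    show "?H \<subseteq> {..<r}" using TB by (auto simp: inacc_def acc_def)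
    fix i j assume i: "i \<in> ?H" and j: "j \<in> {..<r} - ?H"
    then have jB: "j \<in> ?B" "j \<in> F" "j \<notin> T" by (auto simp: inacc_def)
    consider "i \<in> acc c" | "i \<in> T" | "i \<in> ?B - F" using i by blast
    then show "s \<le> ecount c i j"
    proof cases
      case 1 then show ?thesis using ecount_acc[OF assms] jB by blast
    next
      case 2
      then have "\<not> ar c i j" "i \<in> ?B" "i \<noteq> j" using Tcl jB TB by auto
      then show ?thesis using ecount_no_arc[OF assms] by blast
    next
      case 3
      then have "\<not> ar c j i" "j \<noteq> i" using Fcl jB by auto
      then show ?thesis using ecount_no_arc[OF assms jB(1)] by (simp add: ecount_sym)
    qed
  qed
  moreover have "card ?H = card (acc c) + card (T \<union> (?B - F))"
    using TB acc_inacc(2)[of c] finT by (intro card_Un_disjoint) auto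
  moreover have "card (T \<union> (?B - F)) \<le> card T + card (?B - F)" by (rule card_Un_le)
  moreover have "card (?B - F) = card ?B - card F" using FB finF by (simp add: card_Diff_subset)
  ultimately have "card (T \<union> (?B - F)) + card (acc c) \<le> 3"
    using cT big[OF i0(1)] cardB acc3 r11 unfolding F_def by linarith
  then show ?thesis using that[OF TB FB _ _ Fcl Tcl] reachF by (auto simp: rc_def)
qed

text \<open>At least r - 3 >= 8 classes lie outside \<open>T\<close>, and \<open>x\<close> has at
  most 7 neighbours. The class missed is inaccessible because \<open>x\<close> has neighbours in all
  accessible ones.\<close>

lemma x_free_class:
  assumes "config c x" "T \<subseteq> inacc c" "card T \<le> 3"
  shows "\<exists>i\<in>inacc c - T. nb x (Cl c i) = {}"
proof (rule ccontr)
  assume none: "\<not> ?thesis"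
  have "{..<r} - T \<subseteq> c ` nb x V"
  proof
    fix i assume i: "i \<in> {..<r} - T"
    then have "nb x (Cl c i) \<noteq> {}" using none x_hits[OF assms(1)] by (auto simp: inacc_def)
    then show "i \<in> c ` nb x V" by (auto simp: nb_def cls_def)
  qed
  then have "card ({..<r} - T) \<le> card (nb x V)"
    using finV by (intro surj_card_le) (auto simp: nb_def)
  moreover have "card ({..<r} - T) = r - card T"
    using assms(2) by (subst card_Diff_subset) (auto simp: inacc_def intro: finite_subset)
  ultimately show False using degx assms(3) r11 by linarith
qed

text \<open>Take \<open>u\<close> at maximum distance from \<open>sm\<close>: shortest paths from
  the other classes avoid it. It equals \<open>sm\<close> only if all distances are 0.\<close>

lemma terminal_class:
  assumes "config c x"
  obtains u where "u \<in> acc c" "u = sm \<Longrightarrow> acc c = {sm}"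
    "\<forall>i\<in>acc c. i \<noteq> u \<longrightarrow> (\<lambda>i j. ar c i j \<and> i \<noteq> u \<and> j \<noteq> u)\<^sup>*\<^sup>* i sm"
proof -
  define d where "d i = (LEAST n. (ar c ^^ n) i sm)" for i
  have ex: "\<exists>n. (ar c ^^ n) i sm" if "i \<in> acc c" for i
    using that by (simp add: acc_def rtranclp_power)
  have dI: "(ar c ^^ d i) i sm" if "i \<in> acc c" for i
    unfolding d_def using LeastI_ex[OF ex[OF that]] .
  have d_le: "d i \<le> n" if "(ar c ^^ n) i sm" for i n
    unfolding d_def using that by (rule Least_le)
  have "Max (d ` acc c) \<in> d ` acc c" using acc_nonempty by (intro Max_in) auto
  then obtain u where u0: "u \<in> acc c" "Max (d ` acc c) = d u" by blast
  have "d i \<le> d u" if "i \<in> acc c" for i unfolding u0(2)[symmetric] using that by (intro Max_ge) auto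
  with u0 have u: "u \<in> acc c" "\<forall>i\<in>acc c. d i \<le> d u" by auto
  have "acc c = {sm}" if "u = sm"
  proof -
    have "d u = 0" using d_le[of 0 sm] that by simp
    then have "d i = 0" if "i \<in> acc c" for i using u(2) that by fastforce
    then have "i = sm" if "i \<in> acc c" for i using dI[OF that] that by simp
    then show ?thesis using sm_acc(1) by blast
  qed
  moreover have "(\<lambda>i j. ar c i j \<and> i \<noteq> u \<and> j \<noteq> u)\<^sup>*\<^sup>* i sm" if "i \<in> acc c" "i \<noteq> u" for i
    using that
  proof (induction "d i" arbitrary: i rule: less_induct)
    case less
    show ?case
    proof (cases "d i")
      case 0
      then show ?thesis using dI[OF less.prems(1)] by simp
    next
      case (Suc n)
      then obtain j where j: "ar c i j" "(ar c ^^ n) j sm"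
        using dI[OF less.prems(1)] relpowp_Suc_D2 by metis
      then have R: "(ar c)\<^sup>*\<^sup>* j sm" using relpowp_imp_rtranclp by metis
      have jacc: "j \<in> acc c" using R reach_less[OF assms R sm_less] by (simp add: acc_def)
      have dj: "d j < d i" using d_le[OF j(2)] Suc by simp
      then have "j \<noteq> u" using u(2) less.prems(1) by force
      then have "(\<lambda>i j. ar c i j \<and> i \<noteq> u \<and> j \<noteq> u)\<^sup>*\<^sup>* j sm" using less.hyps[OF dj jacc] by blast
      then show ?thesis using j(1) \<open>j \<noteq> u\<close> less.prems(2)
        by (intro converse_rtranclp_into_rtranclp[of _ i j]) auto
    qed
  qed
  ultimately show ?thesis using that u(1) by blast
qed

end

subsection \<open>Colourings with the most accessible classes\<close>

text \<open>By \<open>acc_max\<close>, a recolouring that keeps all accessible classes accessible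
  creates no new ones. Class \<open>u\<close> comes from \<open>terminal_class\<close> and can be
  altered without cutting off the others; \<open>T\<close> and \<open>F\<close> come from
  \<open>inacc_structure\<close>.\<close>

locale max_config = float_graph adj V r s sm x
  for adj :: "'a \<Rightarrow> 'a \<Rightarrow> bool" and V r s sm x +
  fixes c :: "'a \<Rightarrow> nat" and u :: nat and T F :: "nat set"
  assumes cfg: "config c x"
    and acc_max: "\<And>c'. config c' x \<Longrightarrow> card (acc c') \<le> card (acc c)"
    and u_acc: "u \<in> acc c"
    and u_sm: "u = sm \<Longrightarrow> acc c = {sm}"
    and u_terminal: "\<And>i. i \<in> acc c \<Longrightarrow> i \<noteq> u \<Longrightarrow> (\<lambda>i j. ar c i j \<and> i \<noteq> u \<and> j \<noteq> u)\<^sup>*\<^sup>* i sm"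
    and T_sub: "T \<subseteq> inacc c" and F_sub: "F \<subseteq> inacc c"
    and TF_card: "card (T \<union> (inacc c - F)) + card (acc c) \<le> 3"
    and F_reach: "\<And>i j. i \<in> inacc c \<Longrightarrow> i \<notin> T \<Longrightarrow> j \<in> F \<Longrightarrow> (ar c)\<^sup>*\<^sup>* i j"
    and F_closed: "\<And>i j. i \<in> F \<Longrightarrow> j \<in> inacc c \<Longrightarrow> j \<notin> F \<Longrightarrow> \<not> ar c i j"
    and T_closed: "\<And>i j. i \<in> T \<Longrightarrow> j \<in> inacc c \<Longrightarrow> j \<notin> T \<Longrightarrow> \<not> ar c i j"
begin

text \<open>\<open>Sol z\<close> consists of the vertices attached to class \<open>u\<close> only through \<open>z\<close>; \<open>exch z y\<close> says
  that \<open>z\<close> can take the place of \<open>y\<close> in the inaccessible classes.\<close>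

definition "BV = {v \<in> V - {x}. c v \<in> inacc c}"

definition "Sol z = {y \<in> insert x BV. nb y (Cl c u) = {z}}"

definition "tied z \<longleftrightarrow> (\<forall>k\<in>acc c - {u}. nb z (Cl c k) \<noteq> {})"

definition "exch z y \<longleftrightarrow> (\<exists>p. p \<noteq> [] \<and> distinct p \<and> successively (ar c) p \<and> set p \<subseteq> inacc c \<and>
  last p = c y \<and> nb z (Cl c (hd p) - {y}) = {})"

lemma proper_iff: "proper c' W \<longleftrightarrow> (\<forall>i. \<forall>a\<in>cls c' W i. \<forall>b\<in>cls c' W i. \<not> adj a b)"
  unfolding proper_def cls_def by fastforce

lemma config_ClD:
  assumes "config c' x" "a \<in> Cl c' i" "b \<in> Cl c' i"
  shows "\<not> adj a b"
  using assms unfolding config_def proper_iff by blast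

lemma u_less: "u < r" using u_acc by (simp add: acc_def)

lemma u_inacc: "u \<notin> inacc c" using u_acc acc_inacc(2)[of c] by blast

text \<open>The paths provided by \<open>u_terminal\<close> avoid \<open>u\<close>, so they survive
  any recolouring that alters only \<open>u\<close> among the accessible classes.\<close>

lemma keep_terminal:
  assumes same: "\<And>k. k \<in> acc c \<Longrightarrow> k \<noteq> u \<Longrightarrow> cls c2 (V - {f}) k = Cl c k"
    and i: "i \<in> acc c" "i \<noteq> u"
  shows "(arc c2 (V - {f}))\<^sup>*\<^sup>* i sm"
  using u_terminal[OF i]
proof (induction rule: converse_rtranclp_induct)
  case base
  show ?case by simp
next
  case (step i j)
  have "(ar c)\<^sup>*\<^sup>* j sm" using mono_rtranclp[rule_format, OF _ step(2), of "ar c"] by blast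
  moreover from this have "j < r" using reach_less[OF cfg] sm_less by blast
  ultimately have j: "j \<in> acc c" by (simp add: acc_def)
  have "i < r" using arc_less[OF cfg] step(1) by blast
  then have "i \<in> acc c" using arc_acc[OF cfg] step(1) j by blast
  then have "arc c2 (V - {f}) i j" using step(1) same[of i] same[of j] j by (simp add: arc_def)
  then show ?case using step(3) by (rule converse_rtranclp_into_rtranclp)
qed

text \<open>Otherwise \<open>z\<close> could be moved towards the small class, \<open>y\<close> could take its place, and \<open>x\<close> could
  fill the gap left by \<open>y\<close>.\<close>

lemma tiedI:
  assumes z: "z \<in> Cl c u" and y: "y \<in> Sol z" "y = x \<or> c y \<in> F"
  shows "tied z"
proof (rule ccontr)
  assume "\<not> tied z"
  then obtain k where k: "k \<in> acc c" "k \<noteq> u" "nb z (Cl c k) = {}" by (auto simp: tied_def)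
  have nby: "nb y (Cl c u) = {z}" using y by (simp add: Sol_def)
  \<comment> \<open>Now \<open>y\<close> becomes the uncoloured vertex: \<open>x\<close> enters a
    class outside \<open>T\<close> in which it has no neighbour, and a shift inside the inaccessible
    classes ends at the place of \<open>y\<close>. Accessible classes do not change.\<close>
  obtain c1 where c1: "config c1 y" "\<And>k. k \<in> acc c \<Longrightarrow> cls c1 (V - {y}) k = Cl c k"
  proof (cases "y = x")
    case True
    then show ?thesis using that[of c] cfg by simp
  next
    case False
    then have yF: "c y \<in> F" and yW: "y \<in> V - {x}" using y by (auto simp: Sol_def BV_def)
    have "card T \<le> 3" using TF_card card_mono[of "T \<union> (inacc c - F)" T] T_sub
      by (metis Un_upper1 add_leD1 fin_acc(2) finite_Diff finite_Un finite_subset order_trans)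
    then obtain i where i: "i \<in> inacc c - T" "nb x (Cl c i) = {}"
      using x_free_class[OF cfg T_sub] by blast
    have "(ar c)\<^sup>*\<^sup>* i (c y)" using F_reach i yF by blast
    then obtain p where p: "p \<noteq> []" "hd p = i" "last p = c y" "distinct p" "successively (ar c) p"
      "set p \<subseteq> inacc c"
      using inacc_path[OF cfg, of i "c y"] i yF F_sub by blast
    let ?W = "V - {x}"
    have "\<exists>c'. proper c' (insert x (?W - {y})) \<and>
      (\<forall>v\<in>?W. c v \<notin> set p \<longrightarrow> c' v = c v) \<and>
      (\<forall>v\<in>insert x ?W. v = x \<or> c v \<in> set p \<longrightarrow> c' v \<in> set p) \<and>
      (\<forall>i. card (cls c' (insert x (?W - {y})) i) = card (cls c ?W i - {y}) + (if i = last p then 1 else 0))"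
    proof (rule shift_along_path)
      show "proper c ?W" using cfg by (simp add: config_def)
      show "{y} \<subseteq> cls c ?W (last p)" using yW p by (simp add: cls_def)
      show "nb x (cls c ?W (hd p) - {y}) = {}" using i p by (auto simp: nb_def)
    qed (use p finV in auto)
    moreover have "insert x (?W - {y}) = V - {y}" using False xV by auto
    ultimately obtain c1 where c1: "proper c1 (V - {y})" "\<forall>v\<in>?W. c v \<notin> set p \<longrightarrow> c1 v = c v"
      "\<forall>v\<in>insert x ?W. v = x \<or> c v \<in> set p \<longrightarrow> c1 v \<in> set p"
      "\<forall>i. card (cls c1 (V - {y}) i) = card (Cl c i - {y}) + (if i = c y then 1 else 0)"
      using p(3) by auto
    have cell: "c1 v \<in> inacc c \<or> (v \<in> ?W \<and> c1 v = c v)" if "v \<in> V" for v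
      using c1(2,3) p(6) that by blast
    have "config c1 y"
      unfolding config_def
    proof (intro conjI allI impI ballI)
      show "y \<in> V" "proper c1 (V - {y})" using yW c1 by auto
      show "c1 v < r" if "v \<in> V - {y}" for v
        using cell[of v] that cfg by (auto simp: config_def inacc_def)
      show "card (cls c1 (V - {y}) i) = (if i = sm then s - 1 else s)" if "i < r" for i
      proof -
        have "card (Cl c i - {y}) + (if i = c y then 1 else 0) = card (Cl c i)"
        proof (cases "i = c y")
          case True
          then have "y \<in> Cl c i" using yW by (simp add: cls_def)
          then show ?thesis using True card_Suc_Diff1[OF finCl(1)] by simp
        next
          case False
          then have "Cl c i - {y} = Cl c i" by (auto simp: cls_def)
          then show ?thesis using False by simp
        qed
        then show ?thesis using c1(4) cfg that by (simp add: config_def)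
      qed
    qed
    moreover have "cls c1 (V - {y}) k = Cl c k" if "k \<in> acc c" for k
    proof -
      have kn: "k \<notin> inacc c" using that acc_inacc(2)[of c] by blast
      have yk: "c y \<noteq> k" using kn yF F_sub by blast
      show ?thesis
      proof (intro set_eqI iffI)
        fix v assume "v \<in> cls c1 (V - {y}) k"
        then have v: "v \<in> V" "c1 v = k" by (auto simp: cls_def)
        then show "v \<in> Cl c k" using cell[OF v(1)] kn by (auto simp: cls_def)
      next
        fix v assume v: "v \<in> Cl c k"
        then have "c v \<notin> set p" using kn p(6) by (auto simp: cls_def)
        then show "v \<in> cls c1 (V - {y}) k" using v yk c1(2) by (auto simp: cls_def)
      qed
    qed
    ultimately show ?thesis using that by blast
  qed
  have Cu: "cls c1 (V - {y}) u = Cl c u" using c1(2) u_acc by blast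
  \<comment> \<open>Next \<open>y\<close> replaces its only neighbour \<open>z\<close> in class
    \<open>u\<close>. The vertex \<open>z\<close> is left uncoloured but fits into class
    \<open>k\<close>, which still reaches \<open>sm\<close>.\<close>
  define c2 where "c2 = c1(y := u)"
  have zy: "z \<in> V" "z \<noteq> y" "c1 z = u" using z Cu by (auto simp: cls_def)
  have yV: "y \<in> V" using c1(1) by (simp add: config_def)
  have clsu: "cls c2 (V - {z}) u = insert y (Cl c u - {z})"
    using zy yV unfolding Cu[symmetric] by (auto simp: cls_def c2_def)
  have clsk: "cls c2 (V - {z}) k = cls c1 (V - {y}) k" if "k \<noteq> u" for k
    using zy that by (auto simp: cls_def c2_def)
  have "config c2 z"
    unfolding config_def
  proof (intro conjI allI impI ballI)
    show "z \<in> V" by (rule zy)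
    show "c2 v < r" if "v \<in> V - {z}" for v
      using that c1(1) u_less by (auto simp: config_def c2_def)
    show "proper c2 (V - {z})"
      unfolding proper_iff
    proof (intro allI ballI)
      fix i a b assume ab: "a \<in> cls c2 (V - {z}) i" "b \<in> cls c2 (V - {z}) i"
      show "\<not> adj a b"
      proof (cases "i = u")
        case True
        have ny: "\<not> adj y w" "\<not> adj w y" if "w \<in> Cl c u - {z}" for w
          using nby that sym by (auto simp: nb_def)
        show ?thesis using ab ny config_ClD[OF cfg, of _ u] irrefl unfolding True clsu by blast
      next
        case False
        then show ?thesis using ab c1(1) clsk unfolding config_def proper_iff by blast
      qed
    qed
    show "card (cls c2 (V - {z}) i) = (if i = sm then s - 1 else s)" if "i < r" for i
    proof (cases "i = u")
      case True
      have "y \<notin> Cl c u" using Cu by (auto simp: cls_def)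
      then have "card (insert y (Cl c u - {z})) = card (Cl c u)"
        using card_Suc_Diff1[OF finCl(1) z] by simp
      then show ?thesis using cfg that unfolding True clsu by (simp add: config_def)
    next
      case False
      then show ?thesis using c1(1) that by (simp add: clsk config_def)
    qed
  qed
  moreover have same: "cls c2 (V - {z}) l = Cl c l" if "l \<in> acc c" "l \<noteq> u" for l
    using clsk[OF that(2)] c1(2)[OF that(1)] by simp
  moreover have "k < r" using k by (simp add: acc_def)
  moreover have "(arc c2 (V - {z}))\<^sup>*\<^sup>* k sm" using keep_terminal[OF same] k by blast
  ultimately show False using no_win k by metis
qed

text \<open>The vertex \<open>z\<close> enters the inaccessible classes along \<open>p\<close>,
  \<open>y\<close> leaves at the end of \<open>p\<close> and takes the place of \<open>z\<close>.
  Accessibility survives, for \<open>u\<close> itself because \<open>z\<close> is tied, and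
  maximality of \<open>acc c\<close> turns the inclusion into equality.\<close>

lemma exchange:
  assumes z: "z \<in> Cl c u" "tied z" and y: "y \<in> Sol z" "y \<noteq> x"
    and p: "p \<noteq> []" "distinct p" "successively (ar c) p" "set p \<subseteq> inacc c"
      "last p = c y" "nb z (Cl c (hd p) - {y}) = {}"
  shows "\<exists>c'. config c' x \<and> acc c' = acc c \<and> Cl c' u = insert y (Cl c u - {z}) \<and>
    (\<forall>v\<in>V - {x}. v \<noteq> z \<longrightarrow> v \<noteq> y \<longrightarrow> c v \<notin> set p \<longrightarrow> c' v = c v) \<and>
    (\<forall>v\<in>V - {x}. v \<noteq> y \<longrightarrow> v = z \<or> c v \<in> set p \<longrightarrow> c' v \<in> set p)"
proof -
  have yW: "y \<in> V - {x}" "c y \<in> inacc c" and nby: "nb y (Cl c u) = {z}"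
    using y by (auto simp: Sol_def BV_def)
  have zW: "z \<in> V - {x}" "c z = u" using z by (auto simp: cls_def)
  have zy: "z \<noteq> y" using zW yW u_inacc by auto
  \<comment> \<open>\<open>z\<close> is removed from class \<open>u\<close> first, so that it can be
    the vertex inserted by the shift; \<open>u\<close> does not lie on \<open>p\<close>.\<close>
  let ?W = "V - {x} - {z}"
  have clsW: "cls c ?W k = Cl c k" if "k \<noteq> u" for k using zW that by (auto simp: cls_def)
  have pu: "u \<notin> set p" using p(4) u_inacc by blast
  have cyu: "c y \<noteq> u" using yW u_inacc by metis
  have "\<exists>c'. proper c' (insert z (?W - {y})) \<and>
    (\<forall>v\<in>?W. c v \<notin> set p \<longrightarrow> c' v = c v) \<and>
    (\<forall>v\<in>insert z ?W. v = z \<or> c v \<in> set p \<longrightarrow> c' v \<in> set p) \<and>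
    (\<forall>i. card (cls c' (insert z (?W - {y})) i) = card (cls c ?W i - {y}) + (if i = last p then 1 else 0))"
  proof (rule shift_along_path)
    have "arc c ?W k l \<longleftrightarrow> ar c k l" if "k \<in> set p" "l \<in> set p" for k l
    proof -
      have "k \<noteq> u" "l \<noteq> u" using that pu by auto
      then show ?thesis unfolding arc_def using clsW by presburger
    qed
    then show "successively (arc c ?W) p"
      using successively_cong[of p "arc c ?W" "ar c" p] p(3) by blast
    show "proper c ?W" using cfg by (auto simp: config_def proper_def)
    show "{y} \<subseteq> cls c ?W (last p)" using yW p zy by (simp add: cls_def)
    have "hd p \<noteq> u" using pu p(1) hd_in_set by metis
    then show "nb z (cls c ?W (hd p) - {y}) = {}" using p(6) clsW by metis
  qed (use p finV in auto)
  moreover have "insert z (?W - {y}) = V - {x} - {y}" using zW zy by auto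
  ultimately obtain c1 where c1: "proper c1 (V - {x} - {y})"
    "\<forall>v\<in>?W. c v \<notin> set p \<longrightarrow> c1 v = c v"
    "\<forall>v\<in>insert z ?W. v = z \<or> c v \<in> set p \<longrightarrow> c1 v \<in> set p"
    "\<forall>i. card (cls c1 (V - {x} - {y}) i) = card (cls c ?W i - {y}) + (if i = c y then 1 else 0)"
    using p(5) by auto
  define c2 where "c2 = c1(y := u)"
  have c2: "c2 y = u" "\<And>v. v \<noteq> y \<Longrightarrow> c2 v = c1 v" by (auto simp: c2_def)
  have cell: "c1 v \<in> inacc c \<or> (v \<in> ?W \<and> c1 v = c v)" if "v \<in> V - {x}" for v
    using c1(2,3) p(4) that by blast
  have unch: "c1 v = c v" if "v \<in> ?W" "c v \<in> acc c" for v
    using c1(2) that p(4) acc_inacc(2)[of c] by blast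
  have clsacc: "cls c1 (V - {x} - {y}) k = Cl c k - {z}" if "k \<in> acc c" for k
  proof -
    have kn: "k \<notin> inacc c" using that acc_inacc(2)[of c] by blast
    show ?thesis
    proof (intro set_eqI iffI)
      fix v assume "v \<in> cls c1 (V - {x} - {y}) k"
      then have v: "v \<in> V - {x}" "c1 v = k" by (auto simp: cls_def)
      then show "v \<in> Cl c k - {z}" using cell[OF v(1)] kn by (auto simp: cls_def)
    next
      fix v assume v: "v \<in> Cl c k - {z}"
      then have "v \<in> ?W" "c v = k" "v \<noteq> y" using yW kn by (auto simp: cls_def)
      then show "v \<in> cls c1 (V - {x} - {y}) k" using unch[of v] that by (auto simp: cls_def)
    qed
  qed
  have clsu: "Cl c2 u = insert y (Cl c u - {z})"
    unfolding clsacc[OF u_acc, symmetric] using yW by (auto simp: cls_def c2_def)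
  have clsk: "Cl c2 k = cls c1 (V - {x} - {y}) k" if "k \<noteq> u" for k
    using that by (auto simp: cls_def c2_def)
  have same: "Cl c2 k = Cl c k" if "k \<in> acc c" "k \<noteq> u" for k
    using clsk[OF that(2)] clsacc[OF that(1)] zW that by (auto simp: cls_def)
  have conf: "config c2 x"
    unfolding config_def
  proof (intro conjI allI impI ballI)
    show "x \<in> V" by (rule xV)
    show "c2 v < r" if "v \<in> V - {x}" for v
      using that cell[of v] cfg u_less by (auto simp: config_def c2_def inacc_def)
    show "proper c2 (V - {x})"
      unfolding proper_iff
    proof (intro allI ballI)
      fix i a b assume ab: "a \<in> Cl c2 i" "b \<in> Cl c2 i"
      show "\<not> adj a b"
      proof (cases "i = u")
        case True
        have ny: "\<not> adj y w" "\<not> adj w y" if "w \<in> Cl c u - {z}" for w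
          using nby that sym by (auto simp: nb_def)
        show ?thesis using ab ny config_ClD[OF cfg, of _ u] irrefl unfolding True clsu by blast
      next
        case False
        then show ?thesis using ab c1(1) clsk unfolding proper_iff by blast
      qed
    qed
    show "card (Cl c2 i) = (if i = sm then s - 1 else s)" if "i < r" for i
    proof (cases "i = u")
      case True
      have "y \<notin> Cl c u" using cyu by (auto simp: cls_def)
      then have "card (insert y (Cl c u - {z})) = card (Cl c u)"
        using card_Suc_Diff1[OF finCl(1) z(1)] by simp
      then show ?thesis using cfg that unfolding True clsu by (simp add: config_def)
    next
      case False
      have "card (Cl c i - {y}) + (if i = c y then 1 else 0) = card (Cl c i)"
      proof (cases "i = c y")
        case True
        then have "y \<in> Cl c i" using yW by (simp add: cls_def)
        then show ?thesis using True card_Suc_Diff1[OF finCl(1)] by simp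
      next
        case False
        then have "Cl c i - {y} = Cl c i" by (auto simp: cls_def)
        then show ?thesis using False by simp
      qed
      then show ?thesis using c1(4) cfg that clsk[OF False] clsW[OF False] by (simp add: config_def)
    qed
  qed
  have other: "i \<in> acc c2" if "i \<in> acc c" "i \<noteq> u" for i
    using keep_terminal[OF same that] that by (simp add: acc_def)
  \<comment> \<open>A vertex \<open>v\<close> witnessing an old arc from \<open>u\<close> to an
    accessible class differs from the tied \<open>z\<close>, hence is still in class
    \<open>u\<close>.\<close>
  have "u \<in> acc c2"
  proof (cases "u = sm")
    case True
    then show ?thesis by (simp add: sm_acc)
  next
    case False
    have "(ar c)\<^sup>*\<^sup>* u sm" using u_acc by (simp add: acc_def)
    then obtain k where k: "ar c u k" "(ar c)\<^sup>*\<^sup>* k sm" using False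
      by (cases rule: converse_rtranclpE) auto
    have "k < r" by (rule reach_less[OF cfg k(2) sm_less])
    then have kacc: "k \<in> acc c" using k(2) by (simp add: acc_def)
    have ku: "k \<noteq> u" using k(1) by (auto simp: arc_def)
    obtain v where v: "v \<in> Cl c u" "nb v (Cl c k) = {}" using k(1) by (auto simp: arc_def)
    have "v \<noteq> z" using v z(2) kacc ku by (auto simp: tied_def)
    then have "ar c2 u k" using v ku same[OF kacc ku] clsu by (auto simp: arc_def)
    then show ?thesis using arc_acc[OF conf u_less _ other[OF kacc ku]] by blast
  qed
  then have "acc c \<subseteq> acc c2" using other by blast
  then have "acc c = acc c2" using acc_max[OF conf] by (intro card_seteq) auto
  moreover have "\<forall>v\<in>V - {x}. v \<noteq> z \<longrightarrow> v \<noteq> y \<longrightarrow> c v \<notin> set p \<longrightarrow> c2 v = c v"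
    using c1(2) c2 by simp
  moreover have "\<forall>v\<in>V - {x}. v \<noteq> y \<longrightarrow> v = z \<or> c v \<in> set p \<longrightarrow> c2 v \<in> set p"
    using c1(3) c2 by simp
  ultimately show ?thesis using conf clsu by (intro exI[of _ c2]) simp
qed

text \<open>After the exchange a vertex \<open>y2\<close> not adjacent to \<open>y\<close> would
  have no neighbour in class \<open>u\<close>, yet it is \<open>x\<close> or still lies in an
  inaccessible class, where this cannot happen.\<close>

lemma joined:
  assumes z: "z \<in> Cl c u" "tied z" and y: "y \<in> Sol z" "y \<noteq> x" "exch z y"
    and y2: "y2 \<in> Sol z" "y2 \<noteq> y"
  shows "adj y y2"
proof (rule ccontr)
  assume nadj: "\<not> adj y y2"
  obtain p where p: "p \<noteq> []" "distinct p" "successively (ar c) p" "set p \<subseteq> inacc c"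
      "last p = c y" "nb z (Cl c (hd p) - {y}) = {}" using y(3) unfolding exch_def by blast
  obtain c' where c': "config c' x" "acc c' = acc c" "Cl c' u = insert y (Cl c u - {z})"
    "\<forall>v\<in>V - {x}. v \<noteq> z \<longrightarrow> v \<noteq> y \<longrightarrow> c v \<notin> set p \<longrightarrow> c' v = c v"
    "\<forall>v\<in>V - {x}. v \<noteq> y \<longrightarrow> v = z \<or> c v \<in> set p \<longrightarrow> c' v \<in> set p"
    using exchange[OF z y(1,2) p] by blast
  have "nb y2 (Cl c u) = {z}" using y2 by (simp add: Sol_def)
  moreover have "\<not> adj y2 y" using nadj sym by blast
  ultimately have free: "nb y2 (Cl c' u) = {}" unfolding c'(3) by (auto simp: nb_def)
  show False
  proof (cases "y2 = x")
    case True
    then show False using free x_hits[OF c'(1)] c'(2) u_acc by blast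
  next
    case False
    then have v: "y2 \<in> V - {x}" "c y2 \<in> inacc c" using y2 by (auto simp: Sol_def BV_def)
    have "y2 \<noteq> z" using v z(1) u_inacc by (auto simp: cls_def)
    then have "c' y2 = c y2 \<or> c' y2 \<in> set p" using c'(4,5) v(1) y2(2) by blast
    then have "c' y2 \<in> inacc c" using v(2) p(4) by auto
    then have "c' y2 \<in> inacc c'" using c'(2) by (simp add: inacc_def)
    moreover have "y2 \<in> Cl c' (c' y2)" using v by (simp add: cls_def)
    ultimately show False using free inacc_hits[OF c'(1)] c'(2) u_acc by metis
  qed
qed

section \<open>Neighbours of a vertex of the terminal class\<close>

definition "free z = {i \<in> inacc c. nb z (Cl c i) = {}}"

text \<open>The neighbours of \<open>z\<close> that cannot simply swap places with \<open>z\<close>,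
  since another neighbour of \<open>z\<close> shares their class.\<close>

definition "dbl z = {y \<in> nb z BV. nb z (Cl c (c y)) \<noteq> {y}}"

lemma finBV [simp]: "finite BV" "finite (nb v BV)" "finite (Sol z)"
  using finV by (auto simp: BV_def nb_def Sol_def)

lemma x_BV [simp]: "x \<notin> BV" by (simp add: BV_def)

lemma BV_sub: "BV \<subseteq> V" by (auto simp: BV_def)

lemma Cl_subset: "Cl c i \<subseteq> V" by (auto simp: cls_def)

lemma BV_UN: "BV = (\<Union>i\<in>inacc c. Cl c i)"
  by (auto simp: BV_def cls_def)

lemma card_BV: "card BV = card (inacc c) * s"
proof -
  have "card BV = (\<Sum>i\<in>inacc c. card (Cl c i))"
    unfolding BV_UN by (rule card_UN_disjoint) (use finV in \<open>auto simp: cls_def\<close>)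
  then show ?thesis using card_Cl_inacc[OF cfg] by simp
qed

lemma card_nb_BV: "card (nb z BV) = (\<Sum>i\<in>inacc c. card (nb z (Cl c i)))"
proof -
  have "nb z BV = (\<Union>i\<in>inacc c. nb z (Cl c i))" by (auto simp: BV_UN nb_def)
  moreover have "card (\<Union>i\<in>inacc c. nb z (Cl c i)) = (\<Sum>i\<in>inacc c. card (nb z (Cl c i)))"
    by (rule card_UN_disjoint) (use finV in \<open>auto simp: cls_def nb_def\<close>)
  ultimately show ?thesis by simp
qed

lemma BV_hits: assumes "y \<in> insert x BV" shows "nb y (Cl c u) \<noteq> {}"
proof (cases "y = x")
  case True
  then show ?thesis using x_hits[OF cfg u_acc] by simp
next
  case False
  then have "c y \<in> inacc c" "y \<in> Cl c (c y)" using assms by (auto simp: BV_def cls_def)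
  then show ?thesis using inacc_hits[OF cfg u_acc] by blast
qed

lemma Sol_nb: "Sol z \<subseteq> nb z (insert x BV)"
  using sym by (auto simp: Sol_def nb_def)

lemma degree_le: assumes "z \<in> V" shows "card (nb z (insert x BV)) \<le> r"
proof -
  have "nb z (insert x BV) \<subseteq> nb z V" using BV_sub xV by (auto simp: nb_def)
  then have "card (nb z (insert x BV)) \<le> card (nb z V)" using finV by (intro card_mono) (auto simp: nb_def)
  then show ?thesis using deg[OF assms] by linarith
qed

text \<open>At least \<open>card (acc c) - 1\<close> of the at most \<open>r\<close> neighbours of a
  tied vertex lie in the other accessible classes.\<close>

lemma tied_degree:
  assumes "z \<in> V" "tied z"
  shows "card (nb z (insert x BV)) + card (acc c) \<le> r + 1"
proof -
  let ?A = "{v \<in> V - {x}. c v \<in> acc c - {u}}"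
  have fin: "finite (nb z ?A)" using finV by (simp add: nb_def)
  have "acc c - {u} \<subseteq> c ` nb z ?A"
  proof
    fix k assume k: "k \<in> acc c - {u}"
    then have "nb z (Cl c k) \<noteq> {}" using assms(2) by (simp add: tied_def)
    then obtain v where "v \<in> nb z (Cl c k)" by blast
    then show "k \<in> c ` nb z ?A" using k by (auto simp: nb_def cls_def)
  qed
  then have "card (acc c - {u}) \<le> card (nb z ?A)" by (rule surj_card_le[OF fin])
  moreover have "card (acc c - {u}) = card (acc c) - 1" using u_acc by simp
  moreover have "card (nb z (insert x BV) \<union> nb z ?A) = card (nb z (insert x BV)) + card (nb z ?A)"
  proof (rule card_Un_disjoint)
    show "finite (nb z (insert x BV))" by (simp add: nb_def)
    show "nb z (insert x BV) \<inter> nb z ?A = {}"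
      using acc_inacc(2)[of c] by (auto simp: nb_def BV_def)
  qed (rule fin)
  moreover have "card (nb z (insert x BV) \<union> nb z ?A) \<le> card (nb z V)"
    using finV BV_sub xV by (intro card_mono) (auto simp: nb_def)
  ultimately show ?thesis using deg[OF assms(1)] by linarith
qed

text \<open>A class with n >= 1 neighbours of \<open>z\<close> contributes 0 to \<open>dbl z\<close>
  if n = 1 and at most n otherwise, in both cases at most 2n - 2.\<close>

lemma dbl_bound: "card (dbl z) + 2 * card (inacc c - free z) \<le> 2 * card (nb z BV)"
proof -
  let ?I = "inacc c - free z"
  have "dbl z = (\<Union>i\<in>?I. dbl z \<inter> Cl c i)"
    by (auto simp: dbl_def free_def nb_def BV_def cls_def)
  then have "card (dbl z) = card (\<Union>i\<in>?I. dbl z \<inter> Cl c i)" by simp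
  also have "\<dots> \<le> (\<Sum>i\<in>?I. card (dbl z \<inter> Cl c i))" by (rule card_UN_le) simp
  finally have 1: "card (dbl z) \<le> (\<Sum>i\<in>?I. card (dbl z \<inter> Cl c i))" .
  have 2: "card (dbl z \<inter> Cl c i) + 2 \<le> 2 * card (nb z (Cl c i))" if i: "i \<in> ?I" for i
  proof (cases "card (nb z (Cl c i)) \<le> 1")
    case True
    have "nb z (Cl c i) \<noteq> {}" using i by (simp add: free_def)
    then have "card (nb z (Cl c i)) = 1" using True by (simp add: le_Suc_eq)
    then obtain y where y: "nb z (Cl c i) = {y}" by (auto simp: card_1_singleton_iff)
    have "w \<notin> dbl z" if "w \<in> Cl c i" for w
    proof
      assume w: "w \<in> dbl z"
      then have "w \<in> nb z (Cl c i)" "c w = i" using that by (auto simp: dbl_def nb_def cls_def)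
      then show False using w y by (auto simp: dbl_def)
    qed
    then have "dbl z \<inter> Cl c i = {}" by blast
    then show ?thesis using y by simp
  next
    case False
    have "card (dbl z \<inter> Cl c i) \<le> card (nb z (Cl c i))"
      by (rule card_mono) (auto simp: dbl_def nb_def)
    then show ?thesis using False by linarith
  qed
  have "(\<Sum>i\<in>?I. card (dbl z \<inter> Cl c i) + 2) \<le> (\<Sum>i\<in>?I. 2 * card (nb z (Cl c i)))"
    using 2 by (rule sum_mono)
  moreover have "(\<Sum>i\<in>?I. card (dbl z \<inter> Cl c i) + 2) = (\<Sum>i\<in>?I. card (dbl z \<inter> Cl c i)) + 2 * card ?I"
    unfolding sum.distrib by simp
  moreover have "(\<Sum>i\<in>?I. 2 * card (nb z (Cl c i))) = 2 * card (nb z BV)"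
  proof -
    have "(\<Sum>i\<in>?I. card (nb z (Cl c i))) = (\<Sum>i\<in>inacc c. card (nb z (Cl c i)))"
      by (rule sum.mono_neutral_left) (auto simp: free_def)
    then show ?thesis by (simp add: card_nb_BV sum_distrib_left[symmetric])
  qed
  ultimately show ?thesis using 1 by linarith
qed

lemma exch_single:
  assumes "y \<in> nb z BV" "y \<notin> dbl z"
  shows "exch z y"
proof -
  have "nb z (Cl c (c y)) = {y}" "c y \<in> inacc c" using assms by (auto simp: dbl_def nb_def BV_def)
  then show ?thesis unfolding exch_def by (intro exI[of _ "[c y]"]) (auto simp: nb_def)
qed

text \<open>\<open>z\<close> enters class \<open>i\<close>, from which every class of
  \<open>F\<close> can be reached by a shift.\<close>

lemma exch_reach:
  assumes "i \<in> free z" "i \<notin> T" "c y \<in> F"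
  shows "exch z y"
proof -
  have i: "i \<in> inacc c" "nb z (Cl c i) = {}" using assms by (auto simp: free_def)
  have "(ar c)\<^sup>*\<^sup>* i (c y)" "c y \<in> inacc c" using F_reach[OF i(1) assms(2,3)] assms(3) F_sub by auto
  then obtain p where "p \<noteq> []" "hd p = i" "last p = c y" "distinct p" "successively (ar c) p"
      "set p \<subseteq> inacc c"
    using inacc_path[OF cfg i(1)] by blast
  then show ?thesis unfolding exch_def using i(2) by (intro exI[of _ p]) (auto simp: nb_def)
qed

text \<open>\<open>R\<close> collects the vertices for which no exchange is known; by
  \<open>joined\<close> all others are adjacent to the whole of \<open>S\<close>.\<close>

lemma solo_bound:
  assumes z: "z \<in> Cl c u" "tied z" and R: "R \<subseteq> S" "S \<subseteq> Sol z"
    and ex: "\<And>y. y \<in> S \<Longrightarrow> y \<notin> R \<Longrightarrow> y \<noteq> x \<and> exch z y"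
  shows "5 * ((card S + 1) * card S) \<le> 36 * (card S + 1) + 5 * (card R * (card R - 1))"
proof (rule near_clique_bound)
  have nb: "S \<subseteq> nb z (insert x BV)" using R Sol_nb by blast
  then show "S \<subseteq> V" using BV_sub xV by (auto simp: nb_def)
  show "z \<in> V" using z Cl_subset by blast
  show "z \<notin> S" using nb irrefl by (auto simp: nb_def)
  show "\<forall>y\<in>S. adj z y" using nb by (auto simp: nb_def)
  show "\<forall>y\<in>S - R. \<forall>y'\<in>S. y' \<noteq> y \<longrightarrow> adj y y'"
    using joined[OF z] ex R(2) by (meson DiffE subsetD)
qed (rule R(1))

lemma T_card: "card T + card (acc c) \<le> 3" "card (inacc c - F) + card (acc c) \<le> 3"
proof -
  have fin: "finite (T \<union> (inacc c - F))" using finite_subset[OF T_sub fin_acc(2)] by simp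
  show "card T + card (acc c) \<le> 3" "card (inacc c - F) + card (acc c) \<le> 3"
    using TF_card card_mono[OF fin, of T] card_mono[OF fin, of "inacc c - F"] by auto
qed

text \<open>If \<open>F\<close> were everything, every solo vertex would tie \<open>z\<close>, and
  \<open>x\<close> could join the double count. Some \<open>z\<close> then has so many solo vertices
  that the near-clique bound fails.\<close>

lemma F_not_all: "F \<noteq> inacc c"
proof
  assume FB: "F = inacc c"
  let ?b = "card (inacc c)" and ?P = "insert x BV"
  have cardP: "card ?P = ?b * s + 1" using card_BV by simp
  have ab: "card (acc c) + ?b = r" by (rule card_acc_inacc)
  have a13: "1 \<le> card (acc c)" "card (acc c) \<le> 3" using card_acc_pos card_acc_le_3[OF cfg] by auto
  have cardU: "card (Cl c u) \<le> s" using cfg u_less by (auto simp: config_def)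
  have "2 * card ?P \<le> (\<Sum>z\<in>Cl c u. card {y\<in>?P. nb y (Cl c u) = {z}} + card (nb z ?P))"
    by (rule double_count_solos) (use BV_hits in auto)
  then have sum: "2 * (?b * s + 1) \<le> (\<Sum>z\<in>Cl c u. card (Sol z) + card (nb z ?P))"
    unfolding cardP by (simp add: Sol_def)
  \<comment> \<open>At most \<open>s\<close> vertices share a total of at least 2bs + 2; the surplus
    2 is due to \<open>x\<close>.\<close>
  have "\<exists>z\<in>Cl c u. 2 * ?b + 1 \<le> card (Sol z) + card (nb z ?P)"
  proof (rule ccontr)
    assume "\<not> ?thesis"
    then have "card (Sol z) + card (nb z ?P) \<le> 2 * ?b" if "z \<in> Cl c u" for z using that by fastforce
    then have "(\<Sum>z\<in>Cl c u. card (Sol z) + card (nb z ?P)) \<le> card (Cl c u) * (2 * ?b)"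
      using sum_bounded_above[of "Cl c u" "\<lambda>z. card (Sol z) + card (nb z ?P)" "2 * ?b"] by simp
    also have "\<dots> \<le> s * (2 * ?b)" using cardU by simp
    finally show False using sum by (simp add: algebra_simps)
  qed
  then obtain z where z: "z \<in> Cl c u" "2 * ?b + 1 \<le> card (Sol z) + card (nb z ?P)" by blast
  have zV: "z \<in> V" using z Cl_subset by blast
  have "card (nb z ?P) \<le> r" by (rule degree_le[OF zV])
  then have "card (Sol z) \<noteq> 0" using z(2) ab a13 r11 by linarith
  then have "Sol z \<noteq> {}" by auto
  then obtain y where y: "y \<in> Sol z" by blast
  then have "y = x \<or> c y \<in> F" using FB by (auto simp: Sol_def BV_def)
  then have tied: "tied z" using tiedI[OF z(1) y] by blast
  then have d: "card (nb z ?P) \<le> ?b + 1" using tied_degree[OF zV tied] ab by linarith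
  then have k: "?b \<le> card (Sol z)" using z(2) by linarith
  define k where "k = card (Sol z)"
  obtain R where R: "R \<subseteq> Sol z" "card R + 2 * card (acc c) \<le> 8 \<or> card R \<le> 1"
    "\<And>y. y \<in> Sol z \<Longrightarrow> y \<notin> R \<Longrightarrow> y \<noteq> x \<and> exch z y"
  proof (cases "free z \<subseteq> T")
    case False
    then obtain i where i: "i \<in> free z" "i \<notin> T" by blast
    show ?thesis
    proof (rule that[of "Sol z \<inter> {x}"])
      have "card (Sol z \<inter> {x}) \<le> card {x}" by (rule card_mono) auto
      then show "card (Sol z \<inter> {x}) + 2 * card (acc c) \<le> 8 \<or> card (Sol z \<inter> {x}) \<le> 1" by simp
      show "y \<noteq> x \<and> exch z y" if "y \<in> Sol z" "y \<notin> Sol z \<inter> {x}" for y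
      proof -
        have "y \<noteq> x" using that by blast
        moreover from this have "c y \<in> F" using that FB by (auto simp: Sol_def BV_def)
        ultimately show ?thesis using exch_reach[OF i] by blast
      qed
    qed simp
  next
    case True
    \<comment> \<open>With a accessible and b inaccessible classes, \<open>z\<close> has at most b +
      1 neighbours in \<open>?P\<close> and misses only the classes in \<open>free z\<close>. So at
      most 2 + 2 \<open>card (free z)\<close> <= 8 - 2a vertices are exceptional.\<close>
    let ?R = "Sol z \<inter> insert x (dbl z)"
    have fT: "finite T" by (rule finite_subset[OF T_sub fin_acc(2)])
    have e: "card (free z) \<le> card T" using True fT by (rule card_mono[rotated])
    have "card (inacc c - free z) = ?b - card (free z)"
      by (rule card_Diff_subset) (auto simp: free_def)
    moreover have "card (free z) \<le> ?b" by (rule card_mono) (auto simp: free_def)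
    ultimately have db: "card (dbl z) + 2 * ?b \<le> 2 * card (nb z BV) + 2 * card (free z)"
      using dbl_bound[of z] by linarith
    have findbl: "finite (dbl z)" by (simp add: dbl_def)
    have cR: "card ?R \<le> 2 + 2 * card (free z)"
    proof (cases "adj z x")
      case True
      then have "nb z ?P = insert x (nb z BV)" by (auto simp: nb_def)
      moreover have "x \<notin> nb z BV" by (simp add: nb_def)
      ultimately have "card (nb z ?P) = card (nb z BV) + 1" by simp
      moreover have "card ?R \<le> card (insert x (dbl z))" using findbl by (intro card_mono) auto
      moreover have "card (insert x (dbl z)) \<le> card (dbl z) + 1" using findbl by (simp add: card_insert_if)
      ultimately show ?thesis using db d by linarith
    next
      case False
      then have "nb z ?P = nb z BV" by (auto simp: nb_def)
      moreover have "x \<notin> Sol z" using False Sol_nb by (auto simp: nb_def)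
      then have "card ?R \<le> card (dbl z)" using findbl by (intro card_mono) auto
      ultimately show ?thesis using db d by simp
    qed
    show ?thesis
    proof (rule that[of ?R])
      show "card ?R + 2 * card (acc c) \<le> 8 \<or> card ?R \<le> 1" using cR e T_card(1) by linarith
      show "y \<noteq> x \<and> exch z y" if "y \<in> Sol z" "y \<notin> ?R" for y
      proof -
        have "y \<noteq> x" "y \<notin> dbl z" using that by auto
        moreover from this have "y \<in> nb z BV" using that Sol_nb by (auto simp: nb_def)
        ultimately show ?thesis using exch_single by blast
      qed
    qed simp
  qed
  have bound: "5 * ((k + 1) * k) \<le> 36 * (k + 1) + 5 * (card R * (card R - 1))"
    unfolding k_def using solo_bound[OF z(1) tied R(1) _ R(3)] by blast
  have mult: "(k + 1) * (5 * m) \<le> 36 * (k + 1) + 5 * (n * (n - 1))" if "m \<le> k" "card R \<le> n" for m n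
  proof -
    have "(k + 1) * m \<le> (k + 1) * k" using that(1) by (rule mult_le_mono2)
    moreover have "(k + 1) * (5 * m) = 5 * ((k + 1) * m)" by (simp only: mult.left_commute)
    moreover have "card R * (card R - 1) \<le> n * (n - 1)" using that by (intro mult_le_mono) auto
    ultimately show ?thesis using bound by linarith
  qed
  have kb: "r \<le> k + card (acc c)" using k ab by (simp add: k_def)
  \<comment> \<open>Here k >= 11 - a. The sharpest case is a = 1, where 50 * 11 = 550 exceeds 36 *
    11 + 5 * 30 = 546.\<close>
  consider "card (acc c) = 1" | "card (acc c) = 2" | "card (acc c) = 3" using a13 by linarith
  then show False
  proof cases
    case 1
    then have "card R \<le> 6" "10 \<le> k" using R(2) kb r11 by auto
    then show False using mult[of 10 6] by simp
  next
    case 2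
    then have "card R \<le> 4" "9 \<le> k" using R(2) kb r11 by auto
    then show False using mult[of 9 4] by simp
  next
    case 3
    then have "card R \<le> 2" "8 \<le> k" using R(2) kb r11 by auto
    then show False using mult[of 8 2] by simp
  qed
qed

end

text \<open>Stated for an arbitrary colouring with the most accessible classes, because
  \<open>no_corner\<close> applies it to the colouring obtained by an exchange.\<close>

lemma (in float_graph) proper_structure:
  assumes "config c x" "\<And>c'. config c' x \<Longrightarrow> card (acc c') \<le> card (acc c)"
  obtains T F where "T \<subseteq> inacc c" "F \<subset> inacc c" "card (T \<union> (inacc c - F)) + card (acc c) \<le> 3"
    "\<forall>i\<in>inacc c - T. \<forall>j\<in>F. (ar c)\<^sup>*\<^sup>* i j"
    "\<forall>i\<in>F. \<forall>j\<in>inacc c - F. \<not> ar c i j"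
    "\<forall>i\<in>T. \<forall>j\<in>inacc c - T. \<not> ar c i j"
proof -
  obtain T F where TF: "T \<subseteq> inacc c" "F \<subseteq> inacc c" "card (T \<union> (inacc c - F)) + card (acc c) \<le> 3"
    "\<forall>i\<in>inacc c - T. \<forall>j\<in>F. (ar c)\<^sup>*\<^sup>* i j"
    "\<forall>i\<in>F. \<forall>j\<in>inacc c - F. \<not> ar c i j"
    "\<forall>i\<in>T. \<forall>j\<in>inacc c - T. \<not> ar c i j"
    using inacc_structure[OF assms(1)] by blast
  obtain u where u: "u \<in> acc c" "u = sm \<Longrightarrow> acc c = {sm}"
    "\<forall>i\<in>acc c. i \<noteq> u \<longrightarrow> (\<lambda>i j. ar c i j \<and> i \<noteq> u \<and> j \<noteq> u)\<^sup>*\<^sup>* i sm"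
    using terminal_class[OF assms(1)] by blast
  interpret max_config adj V r s sm x c u T F
    by unfold_locales (use assms u TF in auto)
  show ?thesis using that[OF TF(1) _ TF(3-6)] TF(2) F_not_all by blast
qed

section \<open>Excluding exceptional classes by weights\<close>

context max_config
begin

text \<open>If \<open>z\<close> misses all exceptional classes, then after exchanging \<open>z\<close> and \<open>y\<close> these are reachable
  through the new class of \<open>z\<close>. So a new exceptional class arises, and there are four classes, each
  almost completely attached to all others, which is too much for the bipartite bound.\<close>

lemma no_corner:
  assumes z: "z \<in> Cl c u" "tied z" and free: "free z = T \<union> (inacc c - F)"
    and card3: "card (free z) + card (acc c) = 3" and acc2: "card (acc c) \<le> 2"
    and y: "y \<in> Sol z" "y \<noteq> x" "y \<notin> dbl z"
    and k: "card (inacc c) \<le> card (Sol z - {x}) + 1"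
  shows False
proof -
  let ?B = "inacc c" and ?O = "free z"
  define j where "j = c y"
  have yBV: "y \<in> BV" "y \<in> nb z BV" and nby: "nb y (Cl c u) = {z}"
    using y Sol_nb by (auto simp: Sol_def nb_def)
  have yV: "y \<in> V - {x}" and jB: "j \<in> ?B" using yBV by (auto simp: BV_def j_def)
  have ex: "exch z y" using exch_single yBV(2) y(3) by blast
  have nbj: "nb z (Cl c j) = {y}" using y(3) yBV(2) by (simp add: dbl_def j_def)
  have jO: "j \<notin> ?O" using nbj by (simp add: free_def)
  have OB: "?O \<subseteq> ?B" by (auto simp: free_def)
  have zV: "z \<in> V - {x}" "c z = u" using z by (auto simp: cls_def)
  have "\<exists>c'. config c' x \<and> acc c' = acc c \<and> Cl c' u = insert y (Cl c u - {z}) \<and>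
    (\<forall>v\<in>V - {x}. v \<noteq> z \<longrightarrow> v \<noteq> y \<longrightarrow> c v \<notin> set [j] \<longrightarrow> c' v = c v) \<and>
    (\<forall>v\<in>V - {x}. v \<noteq> y \<longrightarrow> v = z \<or> c v \<in> set [j] \<longrightarrow> c' v \<in> set [j])"
    by (rule exchange[OF z y(1,2)]) (use jB nbj in \<open>auto simp: j_def nb_def\<close>)
  then obtain c' where c': "config c' x" "acc c' = acc c" "Cl c' u = insert y (Cl c u - {z})"
    and unchanged: "\<forall>v\<in>V - {x}. v \<noteq> z \<longrightarrow> v \<noteq> y \<longrightarrow> c v \<notin> set [j] \<longrightarrow> c' v = c v"
    and moved: "\<forall>v\<in>V - {x}. v \<noteq> y \<longrightarrow> v = z \<or> c v \<in> set [j] \<longrightarrow> c' v \<in> set [j]"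
    by blast
  have ju: "j \<noteq> u" using jB u_inacc by blast
  have c'y: "c' y = u" using c'(3) by (auto simp: cls_def)
  have zy: "z \<noteq> y" using zV(2) ju by (auto simp: j_def)
  have c'z: "c' z = j" using moved zV(1) zy by simp
  have B': "inacc c' = ?B" by (simp add: inacc_def c'(2))
  have c'_eq: "c' v = (if v = y then u else if v = z then j else c v)" if "v \<in> V - {x}" for v
    using unchanged moved that c'y c'z by auto
  have same: "Cl c' i = Cl c i" if "i \<noteq> u" "i \<noteq> j" for i
    using that c'_eq zV by (auto simp: cls_def j_def split: if_splits)
  have sub_j: "Cl c j - {y} \<subseteq> Cl c' j"
    using c'_eq zV ju by (auto simp: cls_def)
  \<comment> \<open>The exchange preserves \<open>acc\<close>, so \<open>c'\<close> is a maximum as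
    well and has its own exceptional classes.\<close>
  have acc_max': "card (acc c'') \<le> card (acc c')" if "config c'' x" for c''
    using acc_max[OF that] c'(2) by simp
  obtain T' F' where raw: "T' \<subseteq> inacc c'" "F' \<subset> inacc c'"
    "card (T' \<union> (inacc c' - F')) + card (acc c') \<le> 3"
    "\<forall>i\<in>inacc c' - T'. \<forall>j\<in>F'. (ar c')\<^sup>*\<^sup>* i j"
    "\<forall>i\<in>F'. \<forall>j\<in>inacc c' - F'. \<not> ar c' i j"
    "\<forall>i\<in>T'. \<forall>j\<in>inacc c' - T'. \<not> ar c' i j"
    by (rule proper_structure[OF c'(1) acc_max'])
  note TF' = raw(1,2,3,5)[unfolded B' c'(2)]
  have Ou: "i \<noteq> u" "i \<noteq> j" if "i \<in> ?O" for i using that OB u_inacc jO by auto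
  have arcO: "ar c' j i" if "i \<in> ?O" for i
  proof -
    have "nb z (Cl c' i) = {}" using that same[OF Ou[OF that]] by (simp add: free_def)
    moreover have "z \<in> Cl c' j" using c'z zV by (simp add: cls_def)
    ultimately show ?thesis using Ou[OF that] by (auto simp: arc_def)
  qed
  let ?Q = "?B - F'"
  \<comment> \<open>In \<open>c'\<close> the vertex \<open>z\<close> lies in class \<open>j\<close>
    and gives arcs from \<open>j\<close> to all of \<open>?O\<close>. If \<open>?Q\<close> were part
    of \<open>?O\<close>, then \<open>j\<close> would lie in the closed set \<open>F'\<close> and
    yet have an arc leaving it.\<close>
  have "\<not> ?Q \<subseteq> ?O"
  proof
    assume sub: "?Q \<subseteq> ?O"
    then have "j \<in> F'" using jO jB by blast
    moreover obtain i where "i \<in> ?Q" using TF'(2) by blast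
    ultimately show False using TF'(4) arcO sub by blast
  qed
  then obtain q where q: "q \<in> ?Q" "q \<notin> ?O" by blast
  let ?H = "acc c \<union> ?O \<union> ?Q"
  have finO: "finite ?O" using finite_subset[OF OB] by simp
  have finH: "finite ?H" using finO by simp
  have disj: "acc c \<inter> ?B = {}" by (rule acc_inacc)
  have c3: "card (acc c \<union> ?O) = 3"
    using card3 finO disj OB by (subst card_Un_disjoint) auto
  have h4: "4 \<le> card ?H"
  proof -
    have "q \<notin> acc c \<union> ?O" using q disj by blast
    then have "card (insert q (acc c \<union> ?O)) = 4" using c3 finO by simp
    moreover have "card (insert q (acc c \<union> ?O)) \<le> card ?H" using q finH by (intro card_mono) auto
    ultimately show ?thesis by simp
  qed
  have h5: "card ?H \<le> 5"
  proof -
    have finT': "finite (T' \<union> ?Q)" using finite_subset[OF TF'(1)] by simp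
    have "card ?Q \<le> card (T' \<union> ?Q)" by (rule card_mono[OF finT']) blast
    then have "card ?Q \<le> 2" using TF'(3) card_acc_pos[of c] by linarith
    then show ?thesis using card_Un_le[of "acc c \<union> ?O" ?Q] c3 by linarith
  qed
  have HB: "?H \<subseteq> {..<r}" using OB acc_inacc(1)[of c] by blast
  let ?L = "{..<r} - ?H"
  \<comment> \<open>The classes of \<open>?O\<close> are unchanged, but class \<open>j\<close> has
    lost \<open>y\<close>; \<open>w\<close> repays the edges between \<open>y\<close> and
    \<open>?O\<close>.\<close>
  define w where "w i l = (if l = j \<and> i \<in> ?O then card (nb y (Cl c i)) else 0)" for i l
  have dense: "s \<le> ecount c' i l + w i l" if i: "i \<in> ?H" and l: "l \<in> ?L" for i l
  proof -
    have lB: "l \<in> ?B" "l \<in> F'" "l \<notin> ?O" using l by (auto simp: inacc_def)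
    consider "i \<in> acc c" | "i \<in> ?Q" | "i \<in> ?O" "i \<notin> ?Q" using i by blast
    then show ?thesis
    proof cases
      case 1
      then show ?thesis using ecount_acc[OF c'(1), of i l] lB B' c'(2) by simp
    next
      case 2
      then have "\<not> ar c' l i" "l \<noteq> i" using TF'(4) lB by auto
      then have "s \<le> ecount c' l i" using ecount_no_arc[OF c'(1)] lB(1) B' by blast
      then show ?thesis by (simp add: ecount_sym)
    next
      case 3
      have il: "i \<noteq> l" using 3 lB by blast
      have iB: "i \<in> ?B" using 3 OB by blast
      have old: "s \<le> ecount c i l"
      proof (cases "i \<in> T")
        case True
        then have "\<not> ar c i l" using T_closed lB free by blast
        then show ?thesis using ecount_no_arc[OF cfg iB il] by blast
      next
        case False
        then have "i \<notin> F" "l \<in> F" using 3 free lB by auto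
        then have "\<not> ar c l i" using F_closed iB by blast
        then have "s \<le> ecount c l i" using ecount_no_arc[OF cfg lB(1) il[symmetric]] by blast
        then show ?thesis by (simp add: ecount_sym)
      qed
      have Ci: "Cl c' i = Cl c i" using same Ou 3 by blast
      show ?thesis
      proof (cases "l = j")
        case False
        have "l \<noteq> u" using lB u_inacc by blast
        then have "Cl c' l = Cl c l" using same False by blast
        then show ?thesis using old Ci by (simp add: ecount_def)
      next
        case True
        let ?P = "{(p, q). p \<in> Cl c i \<and> q \<in> Cl c j \<and> adj p q}"
        let ?P' = "{(p, q). p \<in> Cl c' i \<and> q \<in> Cl c' j \<and> adj p q}"
        let ?N = "(\<lambda>p. (p, y)) ` nb y (Cl c i)"
        have "?P \<subseteq> ?P' \<union> ?N"
        proof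
          fix e assume "e \<in> ?P"
          then obtain p q where e: "e = (p, q)" "p \<in> Cl c i" "q \<in> Cl c j" "adj p q" by blast
          show "e \<in> ?P' \<union> ?N"
          proof (cases "q = y")
            case True
            then have "p \<in> nb y (Cl c i)" using e sym by (simp add: nb_def)
            then show ?thesis using e True by blast
          next
            case False
            then have "q \<in> Cl c' j" using e sub_j by blast
            then show ?thesis using e Ci by blast
          qed
        qed
        moreover have "finite (?P' \<union> ?N)" using fin_epairs[of c' i j] by simp
        ultimately have "card ?P \<le> card (?P' \<union> ?N)" by (rule card_mono[rotated])
        also have "\<dots> \<le> card ?P' + card ?N" by (rule card_Un_le)
        also have "card ?N \<le> card (nb y (Cl c i))" by (rule card_image_le) simp
        finally have "ecount c i j \<le> ecount c' i j + card (nb y (Cl c i))"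
          by (simp add: ecount_def)
        then show ?thesis using old True 3 by (simp add: w_def)
      qed
    qed
  qed
  \<comment> \<open>Among its at most \<open>r\<close> neighbours, \<open>y\<close> has
    \<open>z\<close> and at least b - 2 other solo vertices of \<open>z\<close>. None of these lies
    in \<open>?O\<close>, so at most r - 1 - (b - 2) = a + 1 <= 3 neighbours are left there.\<close>
  have w_sum: "(\<Sum>i\<in>?H. \<Sum>l\<in>?L. w i l) \<le> 3"
  proof -
    have "(\<Sum>l\<in>?L. w i l) \<le> (if i \<in> ?O then card (nb y (Cl c i)) else 0)" for i
      unfolding w_def by (auto simp: if_distrib[of card] sum.delta' cong: if_cong)
    then have "(\<Sum>i\<in>?H. \<Sum>l\<in>?L. w i l) \<le> (\<Sum>i\<in>?H. if i \<in> ?O then card (nb y (Cl c i)) else 0)"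
      by (rule sum_mono)
    also have "\<dots> = (\<Sum>i\<in>?H \<inter> ?O. card (nb y (Cl c i)))"
      using finH by (simp add: sum.inter_restrict)
    also have "?H \<inter> ?O = ?O" by blast
    also have "(\<Sum>i\<in>?O. card (nb y (Cl c i))) = card (\<Union>i\<in>?O. nb y (Cl c i))"
      by (rule card_UN_disjoint[symmetric]) (use finO finV in \<open>auto simp: nb_def cls_def\<close>)
    also have "\<dots> \<le> 3"
    proof -
      let ?N = "\<Union>i\<in>?O. nb y (Cl c i)" and ?S = "Sol z - {x} - {y}"
      have finN: "finite ?N" using finO by simp
      have SN: "?S \<inter> ?N = {}"
      proof (rule ccontr)
        assume "?S \<inter> ?N \<noteq> {}"
        then obtain v i where v: "v \<in> Sol z" "i \<in> ?O" "v \<in> Cl c i" by (auto simp: nb_def)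
        then have "v \<in> nb z (Cl c i)" using Sol_nb by (auto simp: nb_def)
        then show False using v(2) by (simp add: free_def)
      qed
      have "z \<notin> Sol z" using Sol_nb[of z] irrefl[of z] by (auto simp: nb_def)
      then have zN: "z \<notin> ?N" "z \<notin> ?S" using zV(2) Ou by (auto simp: nb_def cls_def)
      have "card (insert z (?S \<union> ?N)) = 1 + card ?S + card ?N"
        using SN finN zN by (simp add: card_Un_disjoint)
      moreover have "insert z (?S \<union> ?N) \<subseteq> nb y V"
      proof -
        have "v \<in> nb y V" if "v \<in> ?S" for v
        proof -
          have "adj y v" using joined[OF z y(1,2) ex] that by blast
          then show ?thesis using that BV_sub by (auto simp: Sol_def nb_def)
        qed
        moreover have "z \<in> nb y V" using nby zV by (auto simp: nb_def)
        moreover have "?N \<subseteq> nb y V" using Cl_subset by (auto simp: nb_def)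
        ultimately show ?thesis by blast
      qed
      then have "card (insert z (?S \<union> ?N)) \<le> card (nb y V)" using finV by (intro card_mono) (auto simp: nb_def)
      moreover have "card (nb y V) \<le> r" using deg yV by blast
      moreover have "card (Sol z - {x}) = card ?S + 1"
        using card_Suc_Diff1[of "Sol z - {x}" y] y by simp
      ultimately have "card ?N \<le> 3" using k acc2 card_acc_inacc[of c] by linarith
      then show ?thesis .
    qed
    finally show ?thesis .
  qed
  have "(\<Sum>i\<in>?H. \<Sum>l\<in>?L. s) \<le> (\<Sum>i\<in>?H. \<Sum>l\<in>?L. ecount c' i l + w i l)"
    by (intro sum_mono dense)
  also have "\<dots> = (\<Sum>i\<in>?H. \<Sum>l\<in>?L. ecount c' i l) + (\<Sum>i\<in>?H. \<Sum>l\<in>?L. w i l)"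
    by (simp add: sum.distrib)
  finally have le: "(\<Sum>i\<in>?H. \<Sum>l\<in>?L. s) \<le> (\<Sum>i\<in>?H. \<Sum>l\<in>?L. ecount c' i l) + 3" using w_sum by linarith
  have "(\<Sum>i\<in>?H. \<Sum>l\<in>?L. s) = card ?H * (r - card ?H) * s"
    using HB finH by (simp add: card_Diff_subset mult.assoc)
  then have bound: "2 * (card ?H * (r - card ?H) * s) \<le> 5 * (r * s - 1) + 6"
    using le ecount_sum_bound[OF c'(1) HB] by linarith
  obtain h where h: "h = card ?H" by blast
  have fin: "2 * (h * (r - h) * s) \<le> 5 * (r * s - 1) + 6" using bound unfolding h .
  have s2: "2 \<le> s" by (rule s_ge_2[OF cfg])
  obtain m where m: "r = m + 11" using r11 by (metis add.commute le_Suc_ex)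
  \<comment> \<open>The inequality becomes (3r - 32)s <= 1 or (5r - 50)s <= 1, impossible for r >=
    11 and s >= 2.\<close>
  consider "h = 4" | "h = 5" using h4 h5 unfolding h[symmetric] by linarith
  then show False
  proof cases
    case 1
    have "8 * ((m + 7) * s) = 2 * (h * (r - h) * s)" unfolding 1 m by (simp add: algebra_simps)
    then have "8 * ((m + 7) * s) \<le> 5 * ((m + 11) * s - 1) + 6" using fin unfolding m by linarith
    then show False using s2 by (simp add: algebra_simps)
  next
    case 2
    have "10 * ((m + 6) * s) = 2 * (h * (r - h) * s)" unfolding 2 m by (simp add: algebra_simps)
    then have "10 * ((m + 6) * s) \<le> 5 * ((m + 11) * s - 1) + 6" using fin unfolding m by linarith
    then show False using s2 by (simp add: algebra_simps)
  qed
qed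

text \<open>Solo vertices outside \<open>F\<close> may lack an exchange, so they are credited on the
  right. They lie in few classes, so the credits stay small when summed over \<open>z\<close>. If
  the bound fails, \<open>z\<close> has many solo vertices and few exceptions, against the
  near-clique bound or \<open>no_corner\<close>.\<close>

lemma weight_bound:
  assumes zU: "z \<in> Cl c u"
  defines "S \<equiv> Sol z - {x}"
  shows "2 * card S + 2 * card (nb z BV) + 2 \<le> 4 * card (inacc c) + card {y \<in> S. c y \<notin> F}"
proof (rule ccontr)
  let ?b = "card (inacc c)" and ?a = "card (acc c)"
  define k d q where "k = card S" and "d = card (nb z BV)" and "q = card {y \<in> S. c y \<notin> F}"
  assume "\<not> ?thesis"
  then have neg: "4 * ?b + q < 2 * k + 2 * d + 2" by (simp add: k_def d_def q_def)
  have zV: "z \<in> V" using zU Cl_subset by blast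
  have SB: "S \<subseteq> nb z BV" using Sol_nb by (auto simp: S_def nb_def)
  have finS: "finite S" by (simp add: S_def)
  have kd: "k \<le> d" unfolding k_def d_def by (rule card_mono) (use SB in auto)
  have qk: "q \<le> k" unfolding q_def k_def by (rule card_mono) (use finS in auto)
  have d_le: "d \<le> card (nb z (insert x BV))"
    unfolding d_def by (rule card_mono) (auto simp: nb_def)
  have ab: "?a + ?b = r" by (rule card_acc_inacc)
  have "inacc c - F \<noteq> {}" using F_not_all F_sub by blast
  then have "1 \<le> card (inacc c - F)" by (simp add: Suc_le_eq card_gt_0_iff)
  then have a12: "1 \<le> ?a" "?a \<le> 2" using T_card(2) card_acc_pos[of c] by linarith+
  \<comment> \<open>If no solo vertex lies in \<open>F\<close>, then q = k, and with k <= d <= r the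
    negated bound gives 4b < 3r + 2, which fails for b >= r - 2 and r >= 11.\<close>
  have tied: "tied z"
  proof (cases "\<exists>y\<in>S. c y \<in> F")
    case True
    then show ?thesis using tiedI[OF zU] by (auto simp: S_def)
  next
    case False
    then have "{y \<in> S. c y \<notin> F} = S" by blast
    then have "q = k" by (simp add: q_def k_def)
    moreover have "d \<le> r" using d_le degree_le[OF zV] by linarith
    ultimately show ?thesis using neg kd ab a12 r11 by linarith
  qed
  have db: "d \<le> ?b + 1" using tied_degree[OF zV tied] d_le ab by linarith
  have kb: "?b \<le> k + 1" using neg db by linarith
  have q_le: "2 * ?b + q < 2 * k + 4" using neg db by linarith
  have bound: "5 * ((k + 1) * k) \<le> 36 * (k + 1) + 5 * (card R * (card R - 1))"
    if "R \<subseteq> S" "\<And>y. y \<in> S \<Longrightarrow> y \<notin> R \<Longrightarrow> exch z y" for R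
    unfolding k_def using that by (intro solo_bound[OF zU tied that(1)]) (auto simp: S_def)
  have mult: False
    if "R \<subseteq> S" "\<And>y. y \<in> S \<Longrightarrow> y \<notin> R \<Longrightarrow> exch z y" "m \<le> k" "card R \<le> n"
      "36 * (k + 1) + 5 * (n * (n - 1)) < 5 * m * (k + 1)" for R m n
  proof -
    have "(k + 1) * m \<le> (k + 1) * k" using that(3) by (rule mult_le_mono2)
    moreover have "5 * m * (k + 1) = 5 * ((k + 1) * m)" by (simp only: ac_simps)
    moreover have "card R * (card R - 1) \<le> n * (n - 1)" using that(4) by (intro mult_le_mono) auto
    ultimately show False using bound[OF that(1,2)] that(5) by linarith
  qed
  show False
  proof (cases "free z \<subseteq> T")
    case False
    then obtain i where i: "i \<in> free z" "i \<notin> T" by blast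
    let ?R = "{y \<in> S. c y \<notin> F}"
    have ex: "exch z y" if "y \<in> S" "y \<notin> ?R" for y using exch_reach[OF i] that by blast
    have RS: "?R \<subseteq> S" by blast
    have k_le: "k \<le> ?b + 1" using kd db by linarith
    \<comment> \<open>By \<open>q_le\<close>, q <= 2(k - b) + 3, so the three cases admit 1, 3 and 5
      exceptions.\<close>
    consider "k + 1 = ?b" | "k = ?b" | "k = ?b + 1" using kb k_le by linarith
    then show False
    proof cases
      case 1
      then have "card ?R \<le> 1" "8 \<le> k" using q_le q_def ab a12 r11 by linarith+
      then show False using mult[OF RS ex, of 8 1] by simp
    next
      case 2
      then have "card ?R \<le> 3" "9 \<le> k" using q_le q_def ab a12 r11 by linarith+
      then show False using mult[OF RS ex, of 9 3] by simp
    next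
      case 3
      then have "card ?R \<le> 5" "10 \<le> k" using q_le q_def ab a12 r11 by linarith+
      then show False using mult[OF RS ex, of 10 5] by simp
    qed
  next
    case True
    let ?R = "S \<inter> dbl z"
    have ex: "exch z y" if "y \<in> S" "y \<notin> ?R" for y using exch_single that SB by blast
    have RS: "?R \<subseteq> S" by blast
    have finT: "finite T" by (rule finite_subset[OF T_sub fin_acc(2)])
    have e: "card (free z) \<le> card T" by (rule card_mono[OF finT True])
    have "card (inacc c - free z) = ?b - card (free z)"
      by (rule card_Diff_subset) (auto simp: free_def)
    moreover have "card (free z) \<le> ?b" by (rule card_mono) (auto simp: free_def)
    ultimately have dd: "card (dbl z) + 2 * ?b \<le> 2 * d + 2 * card (free z)"
      using dbl_bound[of z] by (simp add: d_def)
    have "card ?R \<le> card (dbl z)" by (rule card_mono) (auto simp: dbl_def)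
    then have cR: "card ?R \<le> 2 + 2 * card (free z)" using dd db by linarith
    have k8: "10 \<le> k + ?a" using kb ab r11 by linarith
    show False
    proof (cases "card (free z) + ?a \<le> 2")
      case True
      consider "?a = 1" | "?a = 2" using a12 by linarith
      then show False
      proof cases
        case 1
        then have "card ?R \<le> 4" "9 \<le> k" using cR True k8 by linarith+
        then show False using mult[OF RS ex, of 9 4] by simp
      next
        case 2
        then have "card ?R \<le> 2" "8 \<le> k" using cR True k8 by linarith+
        then show False using mult[OF RS ex, of 8 2] by simp
      qed
    next
      case False
      \<comment> \<open>The near-clique bound is too weak here: for one accessible class it would
        have to exclude k = 9 with 6 exceptions. But the budget is used up, so \<open>free z\<close>
        is the whole exceptional set and \<open>no_corner\<close> applies.\<close>
      let ?O = "T \<union> (inacc c - F)"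
      have finO: "finite ?O" using finT by simp
      have sub: "free z \<subseteq> ?O" using True by blast
      have "card ?O \<le> card (free z)" using False TF_card by linarith
      then have eq: "free z = ?O" using card_seteq[OF finO sub] by blast
      have card3: "card (free z) + ?a = 3" using False TF_card eq by simp
      have "card ?R < card S"
        using cR card3 k8 a12 unfolding k_def[symmetric] by linarith
      then have "\<not> S \<subseteq> ?R" using card_mono[of ?R S] finS by (metis finite_Int linorder_not_le)
      then obtain y where "y \<in> S" "y \<notin> dbl z" by blast
      then show False using no_corner[OF zU tied eq card3 a12(2), of y] kb
        by (auto simp: S_def k_def)
    qed
  qed
qed

text \<open>Sum \<open>weight_bound\<close> over class \<open>u\<close> and compare with the double
  count. A solo vertex determines its \<open>z\<close>, so the credits total at most
  \<open>card ?Q * s\<close>. One accessible class leaves 4b <= 2, because \<open>u\<close> is the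
  small class; two leave 2s <= s.\<close>

lemma no_max_config: False
proof -
  let ?b = "card (inacc c)" and ?a = "card (acc c)" and ?U = "Cl c u" and ?Q = "inacc c - F"
  let ?S = "\<lambda>z. Sol z - {x}"
  let ?q = "\<lambda>z. {y \<in> ?S z. c y \<notin> F}"
  have ab: "?a + ?b = r" by (rule card_acc_inacc)
  have "?Q \<noteq> {}" using F_not_all F_sub by blast
  then have "1 \<le> card ?Q" by (simp add: Suc_le_eq card_gt_0_iff)
  then have a12: "1 \<le> ?a" "?a \<le> 2" "card ?Q + ?a \<le> 3" using T_card(2) card_acc_pos[of c] by linarith+
  have "2 * card BV \<le> (\<Sum>z\<in>?U. card {y\<in>BV. nb y ?U = {z}} + card (nb z BV))"
    by (rule double_count_solos) (use BV_hits in auto)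
  moreover have "{y\<in>BV. nb y ?U = {z}} = ?S z" for z by (auto simp: Sol_def)
  ultimately have "2 * (?b * s) \<le> (\<Sum>z\<in>?U. card (?S z) + card (nb z BV))" by (simp add: card_BV)
  moreover have "(\<Sum>z\<in>?U. 2 * card (?S z) + 2 * card (nb z BV) + 2) \<le> (\<Sum>z\<in>?U. 4 * ?b + card (?q z))"
    by (intro sum_mono weight_bound)
  moreover have "(\<Sum>z\<in>?U. 2 * card (?S z) + 2 * card (nb z BV) + 2)
     = 2 * (\<Sum>z\<in>?U. card (?S z) + card (nb z BV)) + 2 * card ?U"
    unfolding sum.distrib sum_distrib_left[symmetric] by simp
  moreover have "(\<Sum>z\<in>?U. 4 * ?b + card (?q z)) = 4 * ?b * card ?U + (\<Sum>z\<in>?U. card (?q z))"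
    unfolding sum.distrib by simp
  ultimately have main: "4 * (?b * s) + 2 * card ?U \<le> 4 * ?b * card ?U + (\<Sum>z\<in>?U. card (?q z))"
    by linarith
  have "(\<Sum>z\<in>?U. card (?q z)) = card (\<Union>z\<in>?U. ?q z)"
    by (rule card_UN_disjoint[symmetric]) (auto simp: Sol_def)
  also have "\<dots> \<le> card (\<Union>i\<in>?Q. Cl c i)"
    by (rule card_mono) (auto simp: Sol_def BV_def cls_def finV)
  also have "\<dots> \<le> (\<Sum>i\<in>?Q. card (Cl c i))" by (rule card_UN_le) simp
  also have "\<dots> = card ?Q * s" using card_Cl_inacc[OF cfg] by simp
  finally have q: "(\<Sum>z\<in>?U. card (?q z)) \<le> card ?Q * s" .
  have cU: "card ?U = (if u = sm then s - 1 else s)" using cfg u_less by (simp add: config_def)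
  have s1: "1 \<le> s" using s_pos by simp
  consider "?a = 1" | "?a = 2" using a12 by linarith
  then show False
  proof cases
    case 1
    then obtain i where "acc c = {i}" by (auto simp: card_1_singleton_iff)
    then have "u = sm" using u_acc sm_acc(1)[of c] by auto
    then obtain t where t: "s = t + 1" "card ?U = t" using cU s1 by (metis le_add_diff_inverse2)
    have "card ?Q * s \<le> 2 * s" using a12 1 by (intro mult_le_mono1) linarith
    then have "4 * (?b * s) + 2 * card ?U \<le> 4 * ?b * card ?U + 2 * s" using main q by linarith
    then show False using t 1 ab r11 by (simp add: algebra_simps)
  next
    case 2
    then have "u \<noteq> sm" using u_sm by auto
    moreover have "card ?Q * s \<le> 1 * s" using a12 2 by (intro mult_le_mono1) linarith
    moreover have "4 * ?b * s = 4 * (?b * s)" by (rule mult.assoc)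
    ultimately show False using main q s1 cU by (simp only: if_False)
  qed
qed

end

lemma (in float_graph) no_config: "\<not> config c x"
proof
  assume c: "config c x"
  have "card (acc c') < r + 1" for c' using card_acc_inacc[of c'] by linarith
  then obtain c' where c': "config c' x" "\<And>c''. config c'' x \<Longrightarrow> card (acc c'') \<le> card (acc c')"
    using ex_has_greatest_nat[of "\<lambda>c. config c x" c "\<lambda>c. card (acc c)" "r + 1"] c by blast
  obtain T F where TF: "T \<subseteq> inacc c'" "F \<subseteq> inacc c'"
    "card (T \<union> (inacc c' - F)) + card (acc c') \<le> 3"
    "\<forall>i\<in>inacc c' - T. \<forall>j\<in>F. (ar c')\<^sup>*\<^sup>* i j"
    "\<forall>i\<in>F. \<forall>j\<in>inacc c' - F. \<not> ar c' i j"
    "\<forall>i\<in>T. \<forall>j\<in>inacc c' - T. \<not> ar c' i j"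
    using inacc_structure[OF c'(1)] by blast
  obtain u where u: "u \<in> acc c'" "u = sm \<Longrightarrow> acc c' = {sm}"
    "\<forall>i\<in>acc c'. i \<noteq> u \<longrightarrow> (\<lambda>i j. ar c' i j \<and> i \<noteq> u \<and> j \<noteq> u)\<^sup>*\<^sup>* i sm"
    using terminal_class[OF c'(1)] by blast
  interpret max_config adj V r s sm x c' u T F
    by unfold_locales (use c' u TF in auto)
  show False by (rule no_max_config)
qed

subsection \<open>Reduction to vertex counts divisible by r\<close>

text \<open>The start of the insertion, when no edges are present yet.\<close>

lemma equipartition:
  assumes "finite V" "card V = r * s"
  shows "\<exists>c. (\<forall>v\<in>V. c v < r) \<and> (\<forall>i<r. card (cls c V i) = s)"
proof (cases "s = 0")
  case True
  then have "V = {}" using assms by simp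
  then show ?thesis using True by (simp add: cls_def)
next
  case False
  obtain h where h: "bij_betw h V {0..<r * s}" using ex_bij_betw_finite_nat[OF assms(1)] assms(2) by metis
  let ?c = "\<lambda>v. h v div s"
  have "?c v < r" if "v \<in> V" for v
  proof -
    have "h v < r * s" using h that by (auto simp: bij_betw_def)
    then show ?thesis by (simp add: less_mult_imp_div_less)
  qed
  moreover have "card (cls ?c V i) = s" if i: "i < r" for i
  proof -
    have le: "s + i * s \<le> r * s" using i by (metis Suc_leI mult_Suc mult_le_mono1)
    have div: "n div s = i \<longleftrightarrow> i * s \<le> n \<and> n < s + i * s" for n
      using False by (metis add.commute div_nat_eqI div_times_less_eq_dividend dividend_less_div_times mult.commute mult_Suc neq0_conv)
    have "h ` cls ?c V i = {i * s..<s + i * s}"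
    proof (intro set_eqI iffI)
      fix n assume "n \<in> h ` cls ?c V i"
      then show "n \<in> {i * s..<s + i * s}" using div by (auto simp: cls_def)
    next
      fix n assume n: "n \<in> {i * s..<s + i * s}"
      then have "n \<in> h ` V" using h le by (auto simp: bij_betw_def)
      then show "n \<in> h ` cls ?c V i" using n div by (auto simp: cls_def)
    qed
    moreover have "inj_on h (cls ?c V i)"
      using h by (auto simp: bij_betw_def cls_def intro: inj_on_subset)
    ultimately have "card (cls ?c V i) = card {i * s..<s + i * s}" by (metis card_image)
    then show ?thesis by simp
  qed
  ultimately show ?thesis by (intro exI[of _ ?c]) blast
qed

context sparse_graph
begin

lemma sparse_graph_subset: "Y \<subseteq> V \<Longrightarrow> sparse_graph adj Y"
  using finV sparse bipartite_sparse finite_subset by unfold_locales (auto intro: sym simp: irrefl)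

text \<open>Induction on the set \<open>X\<close> of vertices whose mutual edges are present.
  Vertices outside \<open>X\<close> stay as isolated coloured vertices, so the vertex count remains
  \<open>r * s\<close>.\<close>

lemma divisible_coloring:
  assumes r: "11 \<le> r" and deg: "\<And>v. v \<in> V \<Longrightarrow> card (nb v V) \<le> r" and cardV: "card V = r * s"
  shows "\<exists>c. proper c V \<and> (\<forall>v\<in>V. c v < r) \<and> (\<forall>i<r. card (cls c V i) = s)"
proof -
  define aX where "aX X u v \<longleftrightarrow> adj u v \<and> u \<in> X \<and> v \<in> X" for X u v
  have "\<exists>c. (\<forall>u\<in>V. \<forall>v\<in>V. aX X u v \<longrightarrow> c u \<noteq> c v) \<and> (\<forall>v\<in>V. c v < r) \<and> (\<forall>i<r. card (cls c V i) = s)"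
    if "X \<subseteq> V" for X
    using that
  proof (induction "card X" arbitrary: X)
    case 0
    then have "X = {}" using finite_subset[OF 0(2) finV] by simp
    then show ?case using equipartition[OF finV cardV] by (simp add: aX_def)
  next
    case (Suc n)
    have "X \<noteq> {}" using Suc(2) by auto
    then obtain x where x: "x \<in> X" "card (nb x X) \<le> 7" using low_degree_vertex[OF Suc(3)] by blast
    have "n = card (X - {x})" using Suc(2) x(1) by simp
    then obtain c where c: "\<forall>u\<in>V. \<forall>v\<in>V. aX (X - {x}) u v \<longrightarrow> c u \<noteq> c v" "\<forall>v\<in>V. c v < r"
      "\<forall>i<r. card (cls c V i) = s"
      using Suc(1)[of "X - {x}"] Suc(3) by blast
    have xV: "x \<in> V" using x Suc(3) by blast
    show ?case
    proof (rule ccontr)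
      assume none: "\<not> ?thesis"
      interpret X: symgraph "aX X" using sym irrefl by unfold_locales (auto simp: aX_def)
      have nb_sub: "X.nb v V \<subseteq> nb v V" for v by (auto simp: X.nb_def nb_def aX_def)
      have fin_nb: "finite (nb v W)" if "W \<subseteq> V" for v W
        using finite_subset[OF that finV] by (simp add: nb_def)
      have pairs: "finite {(u, v). u \<in> A \<and> v \<in> B \<and> adj u v}" if "A \<subseteq> V" "B \<subseteq> V" for A B
        by (rule finite_subset[of _ "V \<times> V"]) (use that finV in auto)
      have pair_le: "card {(u, v). u \<in> A \<and> v \<in> B \<and> aX X u v} \<le> card {(u, v). u \<in> A \<and> v \<in> B \<and> adj u v}"
        if "A \<subseteq> V" "B \<subseteq> V" for A B
        by (rule card_mono[OF pairs[OF that]]) (auto simp: aX_def)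
      \<comment> \<open>All new edges meet \<open>x\<close>. Uncolouring \<open>x\<close> makes its
        class \<open>c x\<close> the small one.\<close>
      interpret X: float_graph "aX X" V r s "c x" x
      proof unfold_locales
        show "5 * card {(u, v). u \<in> A \<and> v \<in> A \<and> aX X u v} \<le> 36 * card A" if "A \<subseteq> V" for A
          using sparse[OF that] pair_le[OF that that] by linarith
        show "2 * card {(u, v). u \<in> A \<and> v \<in> B \<and> aX X u v} \<le> 5 * (card A + card B)"
          if "A \<subseteq> V" "B \<subseteq> V" "A \<inter> B = {}" for A B
          using bipartite_sparse[OF that] pair_le[OF that(1,2)] by linarith
        show "card (X.nb v V) \<le> r" if "v \<in> V" for v
          using card_mono[OF fin_nb[OF subset_refl] nb_sub[of v]] deg[OF that] by linarith
        have "X.nb x V = nb x X" using x Suc(3) by (auto simp: X.nb_def nb_def aX_def)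
        then show "card (X.nb x V) \<le> 7" using x by simp
        show "\<exists>i<r. card (cls c' V i) \<noteq> s" if "X.proper c' V" "\<forall>v\<in>V. c' v < r" for c'
          using none that unfolding X.proper_def by blast
      qed (use finV cardV r xV c in auto)
      have "X.config c x"
        unfolding X.config_def
      proof (intro conjI allI impI)
        show "X.proper c (V - {x})" using c(1) unfolding X.proper_def by (auto simp: aX_def)
        show "card (cls c (V - {x}) i) = (if i = c x then s - 1 else s)" if "i < r" for i
        proof -
          have "cls c (V - {x}) i = cls c V i - {x}" by (auto simp: cls_def)
          moreover have "x \<in> cls c V i \<longleftrightarrow> i = c x" using xV by (auto simp: cls_def)
          ultimately show ?thesis using c(3) that by (cases "i = c x") auto
        qed
      qed (use xV c in auto)
      then show False using X.no_config by blast
    qed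
  qed
  from this[of V] show ?thesis unfolding proper_def aX_def by auto
qed

lemma sum_cls:
  assumes "finite Y" "\<forall>v\<in>Y. c v < r"
  shows "(\<Sum>i<r. card (cls c Y i)) = card Y"
proof -
  have "(\<Sum>i<r. card (cls c Y i)) = card (\<Union>i<r. cls c Y i)"
    by (rule card_UN_disjoint[symmetric]) (use assms in \<open>auto simp: cls_def\<close>)
  also have "(\<Union>i<r. cls c Y i) = Y" using assms(2) by (auto simp: cls_def)
  finally show ?thesis .
qed

text \<open>Remove a vertex with at most 7 neighbours. Among the classes of the rest at least 8
  still have size \<open>s\<close>, so one of them contains no neighbour of the vertex and can take
  it.\<close>

lemma small_remainder_coloring:
  assumes r: "11 \<le> r" and deg: "\<And>v. v \<in> V \<Longrightarrow> card (nb v V) \<le> r"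
    and "Y \<subseteq> V" "card Y = r * s + p" "p + 7 \<le> r"
  shows "\<exists>c. proper c Y \<and> (\<forall>v\<in>Y. c v < r) \<and> (\<forall>i<r. card (cls c Y i) = s \<or> card (cls c Y i) = s + 1)"
  using assms(3-5)
proof (induction p arbitrary: Y)
  case 0
  interpret Y: sparse_graph adj Y by (rule sparse_graph_subset[OF 0(1)])
  have "card (nb v Y) \<le> r" if "v \<in> Y" for v
  proof -
    have "card (nb v Y) \<le> card (nb v V)" using 0(1) finV by (intro card_mono) (auto simp: nb_def)
    then show ?thesis using deg[of v] that 0(1) by force
  qed
  then show ?case using Y.divisible_coloring[OF r, of s] 0(2) by auto
next
  case (Suc p)
  have finY: "finite Y" using finite_subset[OF Suc(2) finV] .
  have "Y \<noteq> {}" using Suc(3) by auto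
  then obtain v where v: "v \<in> Y" "card (nb v Y) \<le> 7" using low_degree_vertex[OF Suc(2)] by blast
  let ?Y = "Y - {v}"
  have cY: "card ?Y = r * s + p" using Suc(3) v(1) finY by simp
  moreover have "?Y \<subseteq> V" "p + 7 \<le> r" using Suc by auto
  ultimately obtain c where c: "proper c ?Y" "\<forall>v\<in>?Y. c v < r"
    "\<forall>i<r. card (cls c ?Y i) = s \<or> card (cls c ?Y i) = s + 1"
    using Suc(1)[of ?Y] by blast
  let ?I = "{i. i < r \<and> card (cls c ?Y i) = s}"
  have cI: "r \<le> card ?I + p"
  proof -
    have "(\<Sum>i<r. s + 1) = (\<Sum>i<r. card (cls c ?Y i) + (if i \<in> ?I then 1 else 0))"
      using c(3) by (intro sum.cong) auto
    also have "\<dots> = card ?Y + (\<Sum>i<r. if i \<in> ?I then 1 else 0)"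
      using sum_cls[OF _ c(2)] finY by (simp add: sum.distrib)
    also have "(\<Sum>i<r. if i \<in> ?I then 1 else 0) = card ({..<r} \<inter> ?I)"
      by (subst sum.If_cases) auto
    also have "{..<r} \<inter> ?I = ?I" by auto
    finally show ?thesis using cY by (simp add: algebra_simps)
  qed
  have "\<not> ?I \<subseteq> c ` nb v Y"
  proof
    assume "?I \<subseteq> c ` nb v Y"
    then have "card ?I \<le> card (nb v Y)" using finY by (intro surj_card_le) (auto simp: nb_def)
    then show False using cI v(2) Suc(4) by linarith
  qed
  then obtain i where i: "i < r" "card (cls c ?Y i) = s" "i \<notin> c ` nb v Y" by blast
  let ?c = "c(v := i)"
  have free: "\<not> adj v w" "\<not> adj w v" if "w \<in> Y" "c w = i" for w
    using i(3) that sym by (auto simp: nb_def)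
  have "proper ?c Y"
    using c(1) free irrefl unfolding proper_def by auto
  moreover have "card (cls ?c Y k) = s \<or> card (cls ?c Y k) = s + 1" if k: "k < r" for k
  proof (cases "k = i")
    case True
    have "cls ?c Y i = insert v (cls c ?Y i)" using v(1) by (auto simp: cls_def)
    moreover have "v \<notin> cls c ?Y i" "finite (cls c ?Y i)" using finY by (auto simp: cls_def)
    ultimately have "card (cls ?c Y i) = card (cls c ?Y i) + 1" by simp
    then show ?thesis using i(2) True by simp
  next
    case False
    have "cls ?c Y k = cls c ?Y k" using False by (auto simp: cls_def)
    then show ?thesis using c(3) k by simp
  qed
  moreover have "\<forall>w\<in>Y. ?c w < r" using c(2) i(1) by auto
  ultimately show ?case by blast
qed

end

section \<open>Adding a disjoint clique\<close>

fun clique_adj :: "('a \<Rightarrow> 'a \<Rightarrow> bool) \<Rightarrow> 'a + nat \<Rightarrow> 'a + nat \<Rightarrow> bool" where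
  "clique_adj adj (Inl a) (Inl b) = adj a b"
| "clique_adj adj (Inr i) (Inr j) = (i \<noteq> j)"
| "clique_adj adj _ _ = False"

lemma card_Inl_Inr:
  fixes X :: "('a + 'b) set"
  assumes "finite X"
  shows "card X = card (Inl -` X) + card (Inr -` X)"
proof -
  let ?L = "Inl ` (Inl -` X) :: ('a + 'b) set" and ?R = "Inr ` (Inr -` X) :: ('a + 'b) set"
  have "v \<in> ?L \<union> ?R" if "v \<in> X" for v using that by (cases v) auto
  then have X: "X = ?L \<union> ?R" by auto
  have fin: "finite ?L" "finite ?R" using assms by (auto intro: finite_vimageI)
  have "card X = card ?L + card ?R"
    using card_Un_disjoint[OF fin] X by auto
  moreover have "card ?L = card (Inl -` X)" "card ?R = card (Inr -` X)"
    by (rule card_image; simp)+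
  ultimately show ?thesis by simp
qed

lemma card_clique_pairs:
  assumes "finite X" "finite Y"
  shows "card {(u, v). u \<in> X \<and> v \<in> Y \<and> clique_adj adj u v}
    = card {(a, b). a \<in> Inl -` X \<and> b \<in> Inl -` Y \<and> adj a b}
    + card {(i, j). i \<in> Inr -` X \<and> j \<in> Inr -` Y \<and> i \<noteq> j}"
proof -
  let ?P = "{(a, b). a \<in> Inl -` X \<and> b \<in> Inl -` Y \<and> adj a b}"
  let ?Q = "{(i, j). i \<in> Inr -` X \<and> j \<in> Inr -` Y \<and> i \<noteq> j}"
  have fin: "finite (Inl -` X)" "finite (Inr -` X)" "finite (Inl -` Y)" "finite (Inr -` Y)"
    using assms by (auto intro: finite_vimageI)
  have finPQ: "finite ?P" "finite ?Q"
    by (rule finite_subset[of _ "Inl -` X \<times> Inl -` Y"], use fin in auto)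
      (rule finite_subset[of _ "Inr -` X \<times> Inr -` Y"], use fin in auto)
  have "{(u, v). u \<in> X \<and> v \<in> Y \<and> clique_adj adj u v} = map_prod Inl Inl ` ?P \<union> map_prod Inr Inr ` ?Q"
  proof (intro set_eqI iffI)
    fix e assume "e \<in> {(u, v). u \<in> X \<and> v \<in> Y \<and> clique_adj adj u v}"
    then obtain u v where "e = (u, v)" "u \<in> X" "v \<in> Y" "clique_adj adj u v" by blast
    then show "e \<in> map_prod Inl Inl ` ?P \<union> map_prod Inr Inr ` ?Q"
      by (cases u; cases v) auto
  qed auto
  also have "card \<dots> = card (map_prod Inl Inl ` ?P :: (('a + nat) \<times> ('a + nat)) set)
      + card (map_prod Inr Inr ` ?Q :: (('a + nat) \<times> ('a + nat)) set)"
    using finPQ by (intro card_Un_disjoint) auto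
  also have "\<dots> = card ?P + card ?Q"
    by (simp add: card_image inj_on_def)
  finally show ?thesis .
qed

context sparse_graph
begin

text \<open>Both bounds add up over the two sides of the disjoint union. On n <= 6 clique vertices
  n(n - 1) <= 36n/5, and 2mn <= 5(m + n) whenever m + n <= 6.\<close>

lemma clique_sparse:
  assumes "t \<le> 6"
  shows "sparse_graph (clique_adj adj) (Inl ` V \<union> Inr ` {..<t})"
proof unfold_locales
  let ?V = "Inl ` V \<union> Inr ` {..<t} :: ('a + nat) set"
  show "clique_adj adj v u" if "clique_adj adj u v" for u v
    using that sym by (cases u; cases v) auto
  show "\<not> clique_adj adj v v" for v using irrefl by (cases v) auto
  show finV': "finite ?V" using finV by simp
  have sub: "Inl -` X \<subseteq> V" "Inr -` X \<subseteq> {..<t}" "finite X" "finite (Inr -` X)" if "X \<subseteq> ?V" for X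
    using that finite_subset[OF that finV'] by (auto intro: finite_vimageI)
  have small: "card (Inr -` X) \<le> 6" if "X \<subseteq> ?V" for X
    using card_mono[OF _ sub(2)[OF that]] assms by simp
  show "5 * card {(u, v). u \<in> X \<and> v \<in> X \<and> clique_adj adj u v} \<le> 36 * card X" if X: "X \<subseteq> ?V" for X
  proof -
    let ?n = "card (Inr -` X)"
    have "{(i, j). i \<in> Inr -` X \<and> j \<in> Inr -` X \<and> i \<noteq> j} = Sigma (Inr -` X) (\<lambda>i. Inr -` X - {i})" by auto
    then have "card {(i, j). i \<in> Inr -` X \<and> j \<in> Inr -` X \<and> i \<noteq> j} = ?n * (?n - 1)"
      using sub(4)[OF X] by simp
    moreover have "?n * (?n - 1) \<le> ?n * 6" using small[OF X] by (intro mult_le_mono2) simp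
    ultimately show ?thesis
      using card_clique_pairs[OF sub(3)[OF X] sub(3)[OF X], of adj] sparse[OF sub(1)[OF X]]
        card_Inl_Inr[OF sub(3)[OF X]] by linarith
  qed
  show "2 * card {(u, v). u \<in> X \<and> v \<in> Y \<and> clique_adj adj u v} \<le> 5 * (card X + card Y)"
    if X: "X \<subseteq> ?V" and Y: "Y \<subseteq> ?V" and disj: "X \<inter> Y = {}" for X Y
  proof -
    let ?m = "card (Inr -` X)" and ?n = "card (Inr -` Y)"
    have "{(i, j). i \<in> Inr -` X \<and> j \<in> Inr -` Y \<and> i \<noteq> j} \<subseteq> Inr -` X \<times> Inr -` Y" by auto
    then have "card {(i, j). i \<in> Inr -` X \<and> j \<in> Inr -` Y \<and> i \<noteq> j} \<le> card (Inr -` X \<times> Inr -` Y)"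
      using sub(4)[OF X] sub(4)[OF Y] by (intro card_mono) auto
    then have 1: "card {(i, j). i \<in> Inr -` X \<and> j \<in> Inr -` Y \<and> i \<noteq> j} \<le> ?m * ?n"
      by (simp add: card_cartesian_product)
    have "?m + ?n = card (Inr -` X \<union> Inr -` Y)"
      using sub(4)[OF X] sub(4)[OF Y] disj by (subst card_Un_disjoint) auto
    also have "\<dots> \<le> card {..<t}" using sub(2)[OF X] sub(2)[OF Y] by (intro card_mono) auto
    finally have "?m + ?n \<le> 6" using assms by simp
    then have "?m \<in> {0,1,2,3,4,5,6}" by auto
    then have "2 * (?m * ?n) \<le> 5 * (?m + ?n)" using \<open>?m + ?n \<le> 6\<close> by (elim insertE) auto
    then have 2: "2 * card {(i, j). i \<in> Inr -` X \<and> j \<in> Inr -` Y \<and> i \<noteq> j} \<le> 5 * (?m + ?n)"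
      using 1 by (meson le_trans mult_le_mono2)
    have "Inl -` X \<inter> Inl -` Y = {}" using disj by blast
    from bipartite_sparse[OF sub(1)[OF X] sub(1)[OF Y] this] 2
    show ?thesis
      unfolding card_clique_pairs[OF sub(3)[OF X] sub(3)[OF Y], of adj]
        card_Inl_Inr[OF sub(3)[OF X]] card_Inl_Inr[OF sub(3)[OF Y]]
      by (simp only: distrib_left)
  qed
qed

text \<open>A remainder \<open>p\<close> above r - 7 is completed to \<open>r\<close> by a clique on
  r - p <= 6 vertices. Each class of size s + 1 contains at most one clique vertex, so deleting the
  clique leaves \<open>s\<close> or s + 1.\<close>

lemma equitable_coloring_exists:
  assumes r: "11 \<le> r" and deg: "\<And>v. v \<in> V \<Longrightarrow> card (nb v V) \<le> r"
  shows "\<exists>c s. proper c V \<and> (\<forall>v\<in>V. c v < r) \<and>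
    (\<forall>i<r. card (cls c V i) = s \<or> card (cls c V i) = s + 1)"
proof -
  define s p where "s = card V div r" and "p = card V mod r"
  have cV: "card V = r * s + p" by (simp add: s_def p_def)
  have pr: "p < r" using r by (simp add: p_def)
  show ?thesis
  proof (cases "p + 7 \<le> r")
    case True
    then show ?thesis using small_remainder_coloring[OF r deg subset_refl cV] by blast
  next
    case False
    define t where "t = r - p"
    have t: "t \<le> 6" "p + t = r" using False pr by (auto simp: t_def)
    let ?V = "Inl ` V \<union> Inr ` {..<t} :: ('a + nat) set"
    interpret K: sparse_graph "clique_adj adj" ?V by (rule clique_sparse[OF t(1)])
    have "card ?V = card V + t" using finV by (subst card_Un_disjoint) (auto simp: card_image)
    then have cK: "card ?V = r * (s + 1)" using cV t by simp
    have "card (K.nb v ?V) \<le> r" if "v \<in> ?V" for v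
    proof (cases v)
      case (Inl a)
      have "K.nb v ?V = Inl ` nb a V" using Inl by (auto simp: K.nb_def nb_def)
      then show ?thesis using deg[of a] that Inl by (auto simp: card_image)
    next
      case (Inr i)
      have "K.nb v ?V \<subseteq> Inr ` {..<t}" using Inr by (auto simp: K.nb_def)
      then have "card (K.nb v ?V) \<le> card (Inr ` {..<t} :: ('a + nat) set)" by (intro card_mono) auto
      then show ?thesis using t r by (simp add: card_image)
    qed
    then obtain c where c: "K.proper c ?V" "\<forall>v\<in>?V. c v < r" "\<forall>i<r. card (cls c ?V i) = s + 1"
      using K.divisible_coloring[OF r _ cK] by blast
    let ?c = "\<lambda>a. c (Inl a)"
    have "proper ?c V" using c(1) unfolding proper_def K.proper_def by force
    moreover have "\<forall>v\<in>V. ?c v < r" using c(2) by blast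
    moreover have "card (cls ?c V i) = s \<or> card (cls ?c V i) = s + 1" if i: "i < r" for i
    proof -
      have fin: "finite (cls c ?V i)" using finV by (simp add: cls_def)
      have "Inl -` cls c ?V i = cls ?c V i" by (auto simp: cls_def)
      then have sum: "s + 1 = card (cls ?c V i) + card (Inr -` cls c ?V i)"
        using card_Inl_Inr[OF fin] c(3) i by simp
      have "m = n" if "m \<in> Inr -` cls c ?V i" "n \<in> Inr -` cls c ?V i" for m n
      proof (rule ccontr)
        assume "m \<noteq> n"
        then have "clique_adj adj (Inr m) (Inr n)" by simp
        then show False using c(1) that unfolding K.proper_def by (auto simp: cls_def)
      qed
      then have "card (Inr -` cls c ?V i) \<le> 1"
        using fin by (intro card_le_Suc0_iff_eq[THEN iffD2, unfolded One_nat_def[symmetric]])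
          (auto intro: finite_vimageI)
      then show ?thesis using sum by linarith
    qed
    ultimately show ?thesis by blast
  qed
qed

end

section \<open>Translation to graphs given by edge sets\<close>

theorem theorem3:
  fixes G :: "'a ugraph"
  assumes "fin_simple_graph G"
    and "\<And>H. subgraph H G \<Longrightarrow> real (num_edges H) \<le> 18 / 5 * real (num_verts H)"
    and "\<And>H. subgraph H G \<Longrightarrow> bipartite H \<Longrightarrow>
            real (num_edges H) \<le> 5 / 2 * real (num_verts H)"
    and "max_degree G \<ge> 11"
  shows "\<forall>r \<ge> max_degree G. \<exists>C. equitable_coloring G r C"
proof (intro allI impI)
  fix r assume r: "max_degree G \<le> r"
  let ?V = "verts G" and ?E = "edges G"
  define adj where "adj u v \<longleftrightarrow> {u, v} \<in> ?E" for u v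
  have finV: "finite ?V" and edge: "\<And>e. e \<in> ?E \<Longrightarrow> e \<subseteq> ?V \<and> card e = 2"
    using assms(1) by (auto simp: fin_simple_graph_def)
  have finE: "finite ?E" by (rule finite_subset[of _ "Pow ?V"]) (use edge finV in auto)
  have irr: "\<not> adj v v" for v using edge[of "{v, v}"] by (auto simp: adj_def)
  interpret sparse_graph adj ?V
  proof unfold_locales
    show "adj v u" if "adj u v" for u v using that by (simp add: adj_def insert_commute)
    show "\<not> adj v v" for v by (rule irr)
    show "finite ?V" by (rule finV)
    show "5 * card {(u, v). u \<in> X \<and> v \<in> X \<and> adj u v} \<le> 36 * card X" if X: "X \<subseteq> ?V" for X
    proof -
      let ?F = "{e \<in> ?E. e \<subseteq> X}"
      \<comment> \<open>Each edge yields two ordered pairs, which turns 18 into 36.\<close>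
      let ?D = "\<lambda>e. {(u, v). u \<in> e \<and> v \<in> e \<and> u \<noteq> v}"
      have finF: "finite ?F" using finE by simp
      have two: "finite (?D e) \<and> card (?D e) = 2" if "e \<in> ?F" for e
      proof -
        have "card e = 2" using that edge by blast
        then obtain a b where ab: "e = {a, b}" "a \<noteq> b" by (auto simp: card_2_iff)
        have "?D e = {(a, b), (b, a)}" using ab by auto
        then show ?thesis using ab by simp
      qed
      have "{(u, v). u \<in> X \<and> v \<in> X \<and> adj u v} \<subseteq> (\<Union>e\<in>?F. ?D e)"
      proof
        fix p assume "p \<in> {(u, v). u \<in> X \<and> v \<in> X \<and> adj u v}"
        then obtain u v where p: "p = (u, v)" "u \<in> X" "v \<in> X" "adj u v" by blast
        then have "{u, v} \<in> ?F" "u \<noteq> v" using irr by (auto simp: adj_def)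
        then show "p \<in> (\<Union>e\<in>?F. ?D e)" using p(1) by blast
      qed
      then have "card {(u, v). u \<in> X \<and> v \<in> X \<and> adj u v} \<le> card (\<Union>e\<in>?F. ?D e)"
        using finF two by (intro card_mono) auto
      also have "\<dots> \<le> (\<Sum>e\<in>?F. card (?D e))" by (rule card_UN_le[OF finF])
      also have "\<dots> = 2 * card ?F" using two by simp
      finally have "card {(u, v). u \<in> X \<and> v \<in> X \<and> adj u v} \<le> 2 * card ?F" .
      moreover have "subgraph (X, ?F) G"
        using X edge finite_subset[OF X finV]
        by (auto simp: subgraph_def fin_simple_graph_def verts_def edges_def)
      then have "real (card ?F) \<le> 18 / 5 * real (card X)"
        using assms(2)[of "(X, ?F)"] by (simp add: num_edges_def num_verts_def verts_def edges_def)
      then have "5 * card ?F \<le> 18 * card X" by linarith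
      ultimately show ?thesis by linarith
    qed
    show "2 * card {(u, v). u \<in> X \<and> v \<in> Y \<and> adj u v} \<le> 5 * (card X + card Y)"
      if X: "X \<subseteq> ?V" and Y: "Y \<subseteq> ?V" and disj: "X \<inter> Y = {}" for X Y
    proof -
      let ?P = "{(u, v). u \<in> X \<and> v \<in> Y \<and> adj u v}"
      \<comment> \<open>As \<open>X\<close> and \<open>Y\<close> are disjoint, each edge between
        them arises from only one ordered pair, so no factor 2 appears.\<close>
      let ?F = "(\<lambda>(u, v). {u, v}) ` ?P"
      have fin: "finite X" "finite Y" using X Y finV finite_subset by blast+
      have "inj_on (\<lambda>(u, v). {u, v}) ?P" using disj by (auto simp: inj_on_def doubleton_eq_iff)
      then have cF: "card ?F = card ?P" by (rule card_image)
      have FE: "?F \<subseteq> ?E" by (auto simp: adj_def)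
      have sub: "subgraph (X \<union> Y, ?F) G"
        unfolding subgraph_def fin_simple_graph_def verts_def edges_def fst_conv snd_conv
        using X Y FE edge fin by (auto simp: verts_def edges_def)
      have "independent_set (X \<union> Y, ?F) X" "independent_set (X \<union> Y, ?F) Y"
        using disj by (auto simp: independent_set_def verts_def edges_def doubleton_eq_iff)
      then have "bipartite (X \<union> Y, ?F)"
        unfolding bipartite_def using disj by (intro exI[of _ X] exI[of _ Y]) (simp add: verts_def)
      then have "real (card ?F) \<le> 5 / 2 * real (card (X \<union> Y))"
        using assms(3)[OF sub] by (simp add: num_edges_def num_verts_def verts_def edges_def)
      then have "2 * card ?F \<le> 5 * card (X \<union> Y)" by linarith
      then show ?thesis using cF card_Un_disjoint[OF fin disj] by simp
    qed
  qed
  have "card (nb v ?V) \<le> r" if v: "v \<in> ?V" for v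
  proof -
    have "card (nb v ?V) = card ((\<lambda>u. {v, u}) ` nb v ?V)"
      by (rule card_image[symmetric]) (auto simp: inj_on_def doubleton_eq_iff)
    also have "\<dots> \<le> card {e \<in> ?E. v \<in> e}"
      using finE by (intro card_mono) (auto simp: nb_def adj_def)
    also have "\<dots> = degree G v" by (simp add: degree_def)
    also have "\<dots> \<le> max_degree G" unfolding max_degree_def using finV v by (intro Max_ge) auto
    finally show ?thesis using r by linarith
  qed
  then obtain c s where c: "proper c ?V" "\<forall>v\<in>?V. c v < r"
    "\<forall>i<r. card (cls c ?V i) = s \<or> card (cls c ?V i) = s + 1"
    using equitable_coloring_exists[of r] assms(4) r by (meson order_trans)
  \<comment> \<open>Colours run from 0 to r - 1, the indices of the classes from 1 to r.\<close>
  let ?C = "\<lambda>i. cls c ?V (i - 1)"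
  have "equitable_coloring G r ?C"
    unfolding equitable_coloring_def
  proof (intro conjI ballI)
    show "(\<Union>i\<in>{1..r}. ?C i) = ?V"
    proof (intro set_eqI iffI)
      fix v assume v: "v \<in> ?V"
      then have "c v < r" using c(2) by blast
      then have "Suc (c v) \<in> {1..r}" "v \<in> ?C (Suc (c v))" using v by (auto simp: cls_def)
      then show "v \<in> (\<Union>i\<in>{1..r}. ?C i)" by blast
    qed (auto simp: cls_def)
    show "disjoint_family_on ?C {1..r}" by (auto simp: disjoint_family_on_def cls_def)
    show "independent_set G (?C i)" if "i \<in> {1..r}" for i
      using c(1) unfolding independent_set_def cls_def proper_def adj_def by fastforce
    show "\<bar>int (card (?C i)) - int (card (?C j))\<bar> \<le> 1" if "i \<in> {1..r}" "j \<in> {1..r}" for i j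
    proof -
      have "i - 1 < r" "j - 1 < r" using that by auto
      then have "card (?C i) = s \<or> card (?C i) = s + 1" "card (?C j) = s \<or> card (?C j) = s + 1"
        using c(3) by auto
      then show ?thesis by auto
    qed
  qed
  then show "\<exists>C. equitable_coloring G r C" by blast
qed

end
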